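(* Let $(X,d_X,m_X)$ be a metric measure space with $\operatorname{supp}m_X=X$ satisfying $CD(k,N)$ for an admissible function $k:X\to\mathbb R$ and $N>1$. Assume there are a point $p\in X$, a constant $c>\frac{N-1}4$ and $R>0$ such that $$k(x)\ge c\,d_X(p,x)^{-2}\quad\text{for all }x\in X\text{ with }d_X(p,x)>R.$$ Then $X$ is compact.
   Context: A function $k:X\to\mathbb R$ is admissible if it is lower semicontinuous and locally bounded from below. A metric measure space $(X,d_X,m_X)$ is a complete separable metric space $(X,d_X)$ with a Borel measure $m_X$ such that for every $x\in X$ there is $r>0$ with $m_X(B_r(x))\in(0,\infty)$; also $m_X(X)\ne 0$. A geodesic is a distance-minimizing curve $\gamma:[0,1]\to X$ of constant speed; $|\dot\gamma|$ denotes its speed, i.e. its length. $\mathcal G(X)$ is the set of geodesics with the sup-distance, and $e_t(\gamma)=\gamma(t)$. $\mathcal P_2(X)$ is the set of Borel probability measures with finite second moment, with the $L^2$-Wasserstein distance, and $\mathcal P_2(X,m_X)$ is the subset of $m_X$-absolutely continuous ones. A dynamical optimal coupling of $\mu_0,\mu_1$ is a probability measure $\Pi$ on $\mathcal G(X)$ such that $(e_0,e_1)_*\Pi$ is an optimal coupling (for the cost $d_X^2$) of $\mu_0,\mu_1$. Distortion coefficients. For $\theta>0$ and continuous $\kappa:[0,\theta]\to\mathbb R$ let $\mathfrak s_\kappa$ be the solution of $u''+\kappa u=0$, $u(0)=0$, $u'(0)=1$. For $t\in[0,1]$ put $\sigma^{(t)}_\kappa(\theta)=\mathfrak s_\kappa(t\theta)/\mathfrak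 s_\kappa(\theta)$ if $\mathfrak s_\kappa>0$ on $(0,\theta]$, and $\sigma^{(t)}_\kappa(\theta)=\infty$ otherwise. For lower semicontinuous $\kappa:[0,\theta]\to\mathbb R$ put $\kappa_n(s)=\inf_{r\in[0,\theta]}\{\kappa(r)+n|s-r|\}$ and $\sigma^{(t)}_\kappa(\theta)=\lim_{n\to\infty}\sigma^{(t)}_{\kappa_n}(\theta)\in[0,\infty]$ (consistent for continuous $\kappa$). Put $\sigma_\kappa^{(t)}(0)=t$. For lower semicontinuous $k:X\to\mathbb R$ and a geodesic $\gamma$ with $\theta=|\dot\gamma|$ let $\bar\gamma:[0,\theta]\to X$ be its unit speed reparametrization, $k^+_\gamma=k_\gamma=k\circ\bar\gamma$ and $k^-_\gamma(s)=k_\gamma(\theta-s)$. For $N>0$ set $\sigma^{(t)}_{k^\pm_\gamma,N}(\theta)=\sigma^{(t)}_{k^\pm_\gamma/N}(\theta)$. For $N>1$ set $\tau^{(t)}_{k^\pm_\gamma,N}(\theta)=t^{1/N}\big[\sigma^{(t)}_{k^\pm_\gamma,N-1}(\theta)\big]^{(N-1)/N}$. Conventions: $r\cdot\infty=\infty$ for $r>0$, $0\cdot\infty=0$, $\infty^\alpha=\infty$ for $\alpha>0$. Condition $CD(k,N)$. For $\nu=\varrho m_X+\nu^s$ (Lebesgue decomposition) let $S_N(\nu)=-\int_X\varrho^{1-1/N}\,dm_X$. $(X,d_X,m_X)$ satisfies $CD(k,N)$ if for each pair $\nu_0=\varrho_0m_X,\nu_1=\varrho_1m_X\in\mathcal P_2(X,m_X)$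 with bounded support there exist a dynamical optimal coupling $\Pi$ of $\nu_0,\nu_1$ and a geodesic $(\nu_t)_{t\in[0,1]}\subset\mathcal P_2(X,m_X)$ from $\nu_0$ to $\nu_1$ such that $$S_{N'}(\nu_t)\le-\int\Big[\tau^{(1-t)}_{k^-_\gamma,N'}(|\dot\gamma|)\varrho_0(\gamma(0))^{-1/N'}+\tau^{(t)}_{k^+_\gamma,N'}(|\dot\gamma|)\varrho_1(\gamma(1))^{-1/N'}\Big]d\Pi(\gamma)$$ for all $t\in[0,1]$ and all $N'\ge N$. *)

theory Defs
  imports "HOL-Probability.Probability"
begin

section \<open>Metric measure spaces and admissible functions\<close>

text \<open>The space \<open>X\<close> is the universe of a type of class \<^class>\<open>polish_space\<close>, i.e. a complete
  separable metric space with the distance \<^const>\<open>dist\<close>.\<close>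

definition metric_measure_space :: "'a::polish_space measure \<Rightarrow> bool" where
  "metric_measure_space m \<longleftrightarrow>
     sets m = sets borel \<and>
     (\<forall>x. \<exists>r>0. 0 < emeasure m (ball x r) \<and> emeasure m (ball x r) < \<infinity>) \<and>
     emeasure m UNIV \<noteq> 0"

definition msupp :: "'a::topological_space measure \<Rightarrow> 'a set" where
  "msupp m = {x. \<forall>U. open U \<longrightarrow> x \<in> U \<longrightarrow> 0 < emeasure m U}"

definition lower_semicontinuous :: "('a::topological_space \<Rightarrow> real) \<Rightarrow> bool" where
  "lower_semicontinuous k \<longleftrightarrow> (\<forall>x. \<forall>a < k x. eventually (\<lambda>y. a < k y) (nhds x))"

definition locally_bounded_below :: "('a::topological_space \<Rightarrow> real) \<Rightarrow> bool" where
  "locally_bounded_below k \<longleftrightarrow> (\<forall>x. \<exists>b. eventually (\<lambda>y. b \<le> k y) (nhds x))"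

definition admissible :: "('a::topological_space \<Rightarrow> real) \<Rightarrow> bool" where
  "admissible k \<longleftrightarrow> lower_semicontinuous k \<and> locally_bounded_below k"


section \<open>Geodesics\<close>

text \<open>Distance-minimizing curves of constant speed on \<open>[0,1]\<close>, with respect to a distance \<open>d\<close>;
  used both for \<open>X\<close> and for the Wasserstein space. The speed is \<open>d (\<gamma> 0) (\<gamma> 1)\<close>.\<close>

definition geodesic_wrt :: "('b \<Rightarrow> 'b \<Rightarrow> real) \<Rightarrow> (real \<Rightarrow> 'b) \<Rightarrow> bool" where
  "geodesic_wrt d \<gamma> \<longleftrightarrow>
     (\<forall>s\<in>{0..1}. \<forall>t\<in>{0..1}. d (\<gamma> s) (\<gamma> t) = \<bar>s - t\<bar> * d (\<gamma> 0) (\<gamma> 1))"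

text \<open>A geodesic \<open>[0,1] \<rightarrow> X\<close> is represented by its extension to the real line that is constant on
  \<open>(-\<infinity>,0]\<close> and on \<open>[1,\<infinity>)\<close>. On such functions the distance of the type of bounded continuous
  functions is the sup-distance over \<open>[0,1]\<close>, so that the set of geodesics carries the right
  metric, and \<open>restrict_space borel geodesics\<close> is its Borel sigma-algebra.\<close>

definition geodesics :: "(real \<Rightarrow>\<^sub>C 'a::metric_space) set" where
  "geodesics = {\<gamma>. geodesic_wrt dist (apply_bcontfun \<gamma>) \<and>
                   (\<forall>t. apply_bcontfun \<gamma> t = apply_bcontfun \<gamma> (max 0 (min 1 t)))}"

definition speed :: "(real \<Rightarrow>\<^sub>C 'a::metric_space) \<Rightarrow> real" where
  "speed \<gamma> = dist (apply_bcontfun \<gamma> 0) (apply_bcontfun \<gamma> 1)"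


section \<open>Optimal transport\<close>

definition P2 :: "'a::polish_space measure set" where
  "P2 = {\<mu>. sets \<mu> = sets borel \<and> prob_space \<mu> \<and>
            (\<exists>x0. (\<integral>\<^sup>+ x. ennreal ((dist x0 x)\<^sup>2) \<partial>\<mu>) < \<infinity>)}"

definition P2_ac :: "'a::polish_space measure \<Rightarrow> 'a measure set" where
  "P2_ac m = {\<mu> \<in> P2. absolutely_continuous m \<mu>}"

definition couplings :: "'a::polish_space measure \<Rightarrow> 'a measure \<Rightarrow> ('a \<times> 'a) measure set" where
  "couplings \<mu> \<nu> = {\<pi>. sets \<pi> = sets borel \<and> prob_space \<pi> \<and>
                       distr \<pi> borel fst = \<mu> \<and> distr \<pi> borel snd = \<nu>}"

definition transport_cost :: "('a::polish_space \<times> 'a) measure \<Rightarrow> ennreal" where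
  "transport_cost \<pi> = (\<integral>\<^sup>+ z. ennreal ((dist (fst z) (snd z))\<^sup>2) \<partial>\<pi>)"

definition optimal_coupling ::
    "'a::polish_space measure \<Rightarrow> 'a measure \<Rightarrow> ('a \<times> 'a) measure \<Rightarrow> bool" where
  "optimal_coupling \<mu> \<nu> \<pi> \<longleftrightarrow>
     \<pi> \<in> couplings \<mu> \<nu> \<and> (\<forall>\<pi>' \<in> couplings \<mu> \<nu>. transport_cost \<pi> \<le> transport_cost \<pi>')"

definition W2 :: "'a::polish_space measure \<Rightarrow> 'a measure \<Rightarrow> real" where
  "W2 \<mu> \<nu> = sqrt (enn2real (INF \<pi> \<in> couplings \<mu> \<nu>. transport_cost \<pi>))"

definition dynamical_optimal_coupling ::
    "'a::polish_space measure \<Rightarrow> 'a measure \<Rightarrow> (real \<Rightarrow>\<^sub>C 'a) measure \<Rightarrow> bool" where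
  "dynamical_optimal_coupling \<mu> \<nu> \<Xi> \<longleftrightarrow>
     sets \<Xi> = sets (restrict_space borel geodesics) \<and> prob_space \<Xi> \<and>
     optimal_coupling \<mu> \<nu>
       (distr \<Xi> borel (\<lambda>\<gamma>. (apply_bcontfun \<gamma> 0, apply_bcontfun \<gamma> 1)))"


section \<open>Distortion coefficients\<close>

definition jacobi_solution :: "(real \<Rightarrow> real) \<Rightarrow> real \<Rightarrow> (real \<Rightarrow> real) \<Rightarrow> bool" where
  "jacobi_solution \<kappa> \<theta> u \<longleftrightarrow>
     (\<exists>u'. (\<forall>s\<in>{0..\<theta>}.
              (u has_real_derivative u' s) (at s within {0..\<theta>}) \<and>
              (u' has_real_derivative - (\<kappa> s * u s)) (at s within {0..\<theta>})) \<and>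
           u 0 = 0 \<and> u' 0 = 1)"

text \<open>For \<open>\<theta> > 0\<close> and \<open>\<kappa>\<close> continuous on \<open>[0,\<theta>]\<close> the solution is unique on \<open>[0,\<theta>]\<close>; only its
  values there are used.\<close>

definition gen_sin :: "(real \<Rightarrow> real) \<Rightarrow> real \<Rightarrow> real \<Rightarrow> real" where
  "gen_sin \<kappa> \<theta> = (SOME u. jacobi_solution \<kappa> \<theta> u)"

definition sigma_cont :: "(real \<Rightarrow> real) \<Rightarrow> real \<Rightarrow> real \<Rightarrow> ennreal" where
  "sigma_cont \<kappa> t \<theta> =
     (if \<forall>s\<in>{0<..\<theta>}. gen_sin \<kappa> \<theta> s > 0
      then ennreal (gen_sin \<kappa> \<theta> (t * \<theta>) / gen_sin \<kappa> \<theta> \<theta>) else \<infinity>)"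

definition lip_approx :: "(real \<Rightarrow> real) \<Rightarrow> real \<Rightarrow> nat \<Rightarrow> real \<Rightarrow> real" where
  "lip_approx \<kappa> \<theta> n s = (INF r\<in>{0..\<theta>}. \<kappa> r + real n * \<bar>s - r\<bar>)"

text \<open>The coefficient for lower semicontinuous \<open>\<kappa>\<close>. The approximations, and hence the
  coefficients, increase with \<open>n\<close>, so the limit exists in \<open>[0,\<infinity>]\<close>.\<close>

definition sigma_coeff :: "(real \<Rightarrow> real) \<Rightarrow> real \<Rightarrow> real \<Rightarrow> ennreal" where
  "sigma_coeff \<kappa> t \<theta> =
     (if \<theta> = 0 then ennreal t else lim (\<lambda>n. sigma_cont (lip_approx \<kappa> \<theta> n) t \<theta>))"

text \<open>Power of an extended nonnegative number for positive exponents.\<close>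

definition epowr :: "ennreal \<Rightarrow> real \<Rightarrow> ennreal" where
  "epowr x a = (if x = \<infinity> then \<infinity> else ennreal (enn2real x powr a))"

text \<open>In \<^typ>\<open>ennreal\<close> one has \<open>0 * \<infinity> = 0\<close> and \<open>r * \<infinity> = \<infinity>\<close> for \<open>r > 0\<close>.\<close>

definition tau_coeff :: "(real \<Rightarrow> real) \<Rightarrow> real \<Rightarrow> real \<Rightarrow> real \<Rightarrow> ennreal" where
  "tau_coeff \<kappa> N t \<theta> =
     ennreal (t powr (1 / N)) * epowr (sigma_coeff (\<lambda>s. \<kappa> s / (N - 1)) t \<theta>) ((N - 1) / N)"

definition k_plus :: "('a::metric_space \<Rightarrow> real) \<Rightarrow> (real \<Rightarrow>\<^sub>C 'a) \<Rightarrow> real \<Rightarrow> real" where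
  "k_plus k \<gamma> s = k (apply_bcontfun \<gamma> (s / speed \<gamma>))"

definition k_minus :: "('a::metric_space \<Rightarrow> real) \<Rightarrow> (real \<Rightarrow>\<^sub>C 'a) \<Rightarrow> real \<Rightarrow> real" where
  "k_minus k \<gamma> s = k_plus k \<gamma> (speed \<gamma> - s)"


section \<open>Entropy and the curvature-dimension condition\<close>

definition lebesgue_decomposition ::
    "'a measure \<Rightarrow> 'a measure \<Rightarrow> ('a \<Rightarrow> real) \<Rightarrow> 'a measure \<Rightarrow> bool" where
  "lebesgue_decomposition m \<nu> \<rho> \<nu>s \<longleftrightarrow>
     \<rho> \<in> borel_measurable m \<and> (\<forall>x. 0 \<le> \<rho> x) \<and> sets \<nu>s = sets m \<and>
     (\<forall>A\<in>sets m. emeasure \<nu> A = emeasure (density m (\<lambda>x. ennreal (\<rho> x))) A + emeasure \<nu>s A) \<and>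
     (\<exists>B\<in>sets m. emeasure m B = 0 \<and> emeasure \<nu>s (space m - B) = 0)"

text \<open>The density in the Lebesgue decomposition is unique up to null sets, so the choice below does
  not matter. The integral may be infinite, hence the extended real values.\<close>

definition S_ent :: "'a measure \<Rightarrow> real \<Rightarrow> 'a measure \<Rightarrow> ereal" where
  "S_ent m N \<nu> =
     (let \<rho> = (SOME \<rho>. \<exists>\<nu>s. lebesgue_decomposition m \<nu> \<rho> \<nu>s)
      in - enn2ereal (\<integral>\<^sup>+ x. ennreal (\<rho> x powr (1 - 1 / N)) \<partial>m))"

text \<open>The factor \<open>\<rho> powr (- 1 / N')\<close> is written with \<^const>\<open>inverse\<close> on \<^typ>\<open>ennreal\<close>, which gives \<open>\<infinity>\<close>
  where \<open>\<rho> = 0\<close>, whereas \<open>0 powr (- 1 / N')\<close> would be \<open>0\<close>. The densities \<open>\<rho>0\<close>, \<open>\<rho>1\<close> range over all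
  versions; the integral against \<open>\<Xi>\<close> does not depend on the version.\<close>

definition CD :: "'a::polish_space measure \<Rightarrow> ('a \<Rightarrow> real) \<Rightarrow> real \<Rightarrow> bool" where
  "CD m k N \<longleftrightarrow>
     (\<forall>\<nu>0 \<in> P2_ac m. \<forall>\<nu>1 \<in> P2_ac m. \<forall>\<rho>0 \<rho>1.
        \<rho>0 \<in> borel_measurable m \<longrightarrow> \<rho>1 \<in> borel_measurable m \<longrightarrow>
        (\<forall>x. 0 \<le> \<rho>0 x) \<longrightarrow> (\<forall>x. 0 \<le> \<rho>1 x) \<longrightarrow>
        \<nu>0 = density m (\<lambda>x. ennreal (\<rho>0 x)) \<longrightarrow> \<nu>1 = density m (\<lambda>x. ennreal (\<rho>1 x)) \<longrightarrow>
        bounded (msupp \<nu>0) \<longrightarrow> bounded (msupp \<nu>1) \<longrightarrow>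
        (\<exists>\<Xi> \<nu>.
           dynamical_optimal_coupling \<nu>0 \<nu>1 \<Xi> \<and>
           (\<forall>t\<in>{0..1}. \<nu> t \<in> P2_ac m) \<and> geodesic_wrt W2 \<nu> \<and> \<nu> 0 = \<nu>0 \<and> \<nu> 1 = \<nu>1 \<and>
           (\<forall>t\<in>{0..1}. \<forall>N'\<ge>N.
              S_ent m N' (\<nu> t) \<le>
                - enn2ereal (\<integral>\<^sup>+ \<gamma>.
                    (tau_coeff (k_minus k \<gamma>) N' (1 - t) (speed \<gamma>)
                       * inverse (ennreal (\<rho>0 (apply_bcontfun \<gamma> 0) powr (1 / N')))
                     + tau_coeff (k_plus k \<gamma>) N' t (speed \<gamma>)
                       * inverse (ennreal (\<rho>1 (apply_bcontfun \<gamma> 1) powr (1 / N')))) \<partial>\<Xi>))))"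

end

theory Submission
  imports Defs
begin

text \<open>Boundedness and local compactness both come from one estimate (\<open>CD_ball_estimate\<close>). Transport the
uniform measure of a small ball \<open>B(x,\<delta>)\<close> to the uniform measure of another ball \<open>B(y,\<eta>)\<close>. For \<open>t\<close>
close to \<open>0\<close> the intermediate measure \<open>\<nu>\<^sub>t\<close> is still concentrated on the ball \<open>B(x,r)\<close> with \<open>r\<close> slightly
larger than \<open>\<delta>\<close>, so by Jensen's inequality its entropy is at least \<open>- m(B(x,r))\<^bsup>1/N\<^esup>\<close>, while the
curvature-dimension condition bounds it above by \<open>- C m(B(y,\<eta>))\<^bsup>1/N\<^esup>\<close>, where \<open>C\<close> is any lower bound of
the coefficient \<open>\<tau>\<^bsup>(t)\<^esup>\<close> on the geodesics between the two balls. Hence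
\<open>C m(B(y,\<eta>))\<^bsup>1/N\<^esup> \<le> m(B(x,r))\<^bsup>1/N\<^esup>\<close>.

The bound on the diameter (\<open>CD_bounded\<close>) comes from the case \<open>C = \<infinity>\<close>, which is absurd. A unit speed
geodesic that starts at distance at most \<open>b\<close> from \<open>p\<close> has distance at most \<open>s + b\<close> from \<open>p\<close> at the
parameter \<open>s\<close>. Outside \<open>B(p,R)\<close> it therefore satisfies \<open>k/(N-1) \<ge> c' (s+b)\<^bsup>-2\<^esup>\<close> with
\<open>c' = c/(N-1) > 1/4\<close>. The Euler equation \<open>w'' + c' (s+b)\<^bsup>-2\<^esup> w = 0\<close> has the solution
\<open>(s+b)\<^bsup>1/2\<^esup> sin (\<omega> log ((s+b)/b))\<close> with \<open>\<omega>\<^sup>2 = c' - 1/4\<close>, which vanishes at \<open>s = 0\<close> and again at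
\<open>s = b exp(\<pi>/\<omega>) - b\<close>. By Sturm comparison the coefficient of every longer geodesic of this kind is
infinite (\<open>sigma_coeff_euler_infinite\<close>). In order to have the curvature bound along the whole geodesic,
the transport starts near a point \<open>q\<close> that lies almost on the way from \<open>p\<close> to the far point \<open>y\<close>, at
distance about \<open>R + 3\<close> from \<open>p\<close>: going back to \<open>B(p,R)\<close> would be a detour.

Near a given point \<open>k\<close> is bounded below, and Sturm comparison with \<open>s exp(a s)\<close> gives a positive \<open>C\<close>.
Fixing the target ball, the estimate then bounds the measure of all small balls with nearby centres
from below by one positive constant; as a ball of finite measure contains only finitely many disjoint
sets of this kind, \<open>X\<close> is locally compact (\<open>CD_locally_compact\<close>). Since geodesics join points near any
two given points, \<open>X\<close> is a length space, and the argument of Hopf and Rinow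
(\<open>hopf_rinow_compact_cball\<close>) shows that closed balls are compact.

The measures \<open>\<nu>\<^sub>t\<close> are related to the endpoints only through Wasserstein distances. That they are
concentrated near \<open>B(x,\<delta>)\<close> is obtained by gluing nearly optimal couplings of \<open>(\<nu>\<^sub>0,\<nu>\<^sub>t)\<close> and
\<open>(\<nu>\<^sub>t,\<nu>\<^sub>1)\<close>. Instead of disintegrating over \<open>\<nu>\<^sub>t\<close>, the gluing is done over the pieces of a countable
partition into sets of small diameter, which suffices because only costs up to a small error matter
(\<open>glue_along_countable_partition\<close>, \<open>W2_geodesic_concentration\<close>).\<close>

section \<open>The Jacobi equation\<close>

text \<open>Each integration gains a factor \<open>1/\<beta>\<close> in the norm with weight \<open>exp(-\<beta> s)\<close>; this is what makes the
integral operator of the Jacobi equation a contraction on an interval of any length.\<close>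
lemma abs_integral_le_exp:
  fixes f :: "real \<Rightarrow> real"
  assumes "\<beta> > 0" "0 \<le> C" "0 \<le> r" "continuous_on {0..r} f"
    and le: "\<And>q. q \<in> {0..r} \<Longrightarrow> \<bar>f q\<bar> \<le> C * exp (\<beta> * q)"
  shows "\<bar>integral {0..r} f\<bar> \<le> C / \<beta> * exp (\<beta> * r)"
proof -
  have I: "((\<lambda>q. C * exp (\<beta> * q)) has_integral (C / \<beta> * exp (\<beta> * r) - C / \<beta> * exp (\<beta> * 0))) {0..r}"
    using assms(1,3)
    by (intro fundamental_theorem_of_calculus)
       (auto intro!: derivative_eq_intros simp flip: has_real_derivative_iff_has_vector_derivative)
  have "norm (integral {0..r} f) \<le> integral {0..r} (\<lambda>q. C * exp (\<beta> * q))"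
    using le by (intro Henstock_Kurzweil_Integration.integral_norm_bound_integral
        integrable_continuous_interval assms has_integral_integrable[OF I]) auto
  also have "\<dots> = C / \<beta> * exp (\<beta> * r) - C / \<beta>"
    using integral_unique[OF I] by simp
  finally show ?thesis
    using assms by simp (smt (verit) divide_nonneg_pos)
qed

text \<open>The generalized sine is chosen among all solutions, so nothing can be said about it before a solution
is known to exist. The Jacobi equation is the fixed point equation
\<open>u(s) = \<integral>\<^sub>0\<^sup>s (1 - \<integral>\<^sub>0\<^sup>r \<kappa> u)\<close>, to which Banach's theorem is applied in the unknown
\<open>v(s) = exp(-\<beta> s) u(s)\<close>. With \<open>\<bar>\<kappa>\<bar> \<le> A\<close> the two integrations give the contraction constant \<open>A/\<beta>\<^sup>2\<close>.\<close>
lemma jacobi_solution_exists: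
  fixes \<kappa> :: "real \<Rightarrow> real"
  assumes \<theta>: "\<theta> > 0" and cont: "continuous_on {0..\<theta>} \<kappa>"
  shows "\<exists>u. jacobi_solution \<kappa> \<theta> u"
proof -
  have "bounded (\<kappa> ` {0..\<theta>})"
    using compact_continuous_image[OF cont] by (simp add: compact_imp_bounded)
  then obtain A where A: "A > 0" "\<And>s. s \<in> {0..\<theta>} \<Longrightarrow> \<bar>\<kappa> s\<bar> \<le> A"
    by (auto simp: bounded_pos)
  \<comment> \<open>This weight turns the contraction constant \<open>A/\<beta>\<^sup>2\<close> into \<open>1/2\<close>.\<close>
  define \<beta> where "\<beta> = sqrt (2 * A)"
  have \<beta>: "\<beta> > 0" "\<beta> * \<beta> = 2 * A" using A(1) by (auto simp: \<beta>_def)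
  \<comment> \<open>Functions on \<open>[0,\<theta>]\<close> are extended by their boundary values to live in the type of bounded continuous functions.\<close>
  define cl where "cl s = max 0 (min \<theta> s)" for s
  have cl: "cl s \<in> {0..\<theta>}" "s \<in> {0..\<theta>} \<Longrightarrow> cl s = s" for s using \<theta> by (auto simp: cl_def)
  have cont_cl: "continuous_on UNIV cl" unfolding cl_def by (intro continuous_intros)
  define f where "f v q = \<kappa> q * (exp (\<beta> * q) * apply_bcontfun v q)" for v :: "real \<Rightarrow>\<^sub>C real" and q
  define w where "w v r = 1 - integral {0..r} (f v)" for v :: "real \<Rightarrow>\<^sub>C real" and r
  define G where "G v s = exp (- \<beta> * s) * integral {0..s} (w v)" for v :: "real \<Rightarrow>\<^sub>C real" and s
  have cont_f: "continuous_on {0..\<theta>} (f v)" for v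
    unfolding f_def by (intro continuous_intros cont continuous_on_apply_bcontfun)
  have dw: "(w v has_real_derivative - f v s) (at s within {0..\<theta>})" if "s \<in> {0..\<theta>}" for v s
    unfolding w_def
    by (auto intro!: derivative_eq_intros integral_has_real_derivative cont_f that)
  have cont_w: "continuous_on {0..\<theta>} (w v)" for v
    by (rule DERIV_continuous_on[OF dw])
  have dI: "((\<lambda>s. integral {0..s} (w v)) has_real_derivative w v s) (at s within {0..\<theta>})"
    if "s \<in> {0..\<theta>}" for v s
    by (intro integral_has_real_derivative cont_w that)
  have cont_G: "continuous_on {0..\<theta>} (G v)" for v
    unfolding G_def by (intro continuous_intros DERIV_continuous_on[OF dI])
  have cont_Gcl: "continuous_on UNIV (\<lambda>s. G v (cl s))" for v
    by (rule continuous_on_compose2[OF cont_G cont_cl]) (use cl in blast)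
  have "(\<lambda>s. G v (cl s)) \<in> bcontfun" for v
  proof -
    have "bounded (G v ` {0..\<theta>})"
      using compact_continuous_image[OF cont_G] by (simp add: compact_imp_bounded)
    then have "bounded (range (\<lambda>s. G v (cl s)))"
      by (rule bounded_subset) (use cl in blast)
    then show ?thesis using cont_Gcl by (simp add: bcontfun_def)
  qed
  then have "\<exists>T. \<forall>s. apply_bcontfun T s = G v (cl s)" for v
    by (metis bcontfunE)
  then obtain T where T: "\<And>v s. apply_bcontfun (T v) s = G v (cl s)" by metis
  have lip: "dist (T v) (T v') \<le> 1/2 * dist v v'" for v v'
  proof (rule dist_bound)
    fix s
    define d where "d = dist v v'"
    have d: "\<bar>apply_bcontfun v q - apply_bcontfun v' q\<bar> \<le> d" for q
      using dist_bounded[of v q v'] by (simp add: d_def dist_real_def)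
    have d0: "0 \<le> d" by (simp add: d_def)
    have w_le: "\<bar>w v r - w v' r\<bar> \<le> A * d / \<beta> * exp (\<beta> * r)" if r: "r \<in> {0..\<theta>}" for r
    proof -
      have c: "continuous_on {0..r} (f v)" for v
        by (rule continuous_on_subset[OF cont_f]) (use r in auto)
      have "w v r - w v' r = integral {0..r} (\<lambda>q. f v' q - f v q)"
        unfolding w_def using integral_diff[OF integrable_continuous_interval[OF c[of v']]
          integrable_continuous_interval[OF c[of v]]] by simp
      moreover have "\<bar>integral {0..r} (\<lambda>q. f v' q - f v q)\<bar> \<le> A * d / \<beta> * exp (\<beta> * r)"
      proof (rule abs_integral_le_exp[OF \<beta>(1)])
        fix q assume q: "q \<in> {0..r}"
        have "\<bar>f v' q - f v q\<bar> = \<bar>\<kappa> q\<bar> * (exp (\<beta> * q) * \<bar>apply_bcontfun v q - apply_bcontfun v' q\<bar>)"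
          by (simp add: f_def flip: right_diff_distrib) (simp add: abs_mult abs_minus_commute)
        also have "\<dots> \<le> A * (exp (\<beta> * q) * d)"
          using A q r d by (intro mult_mono) auto
        finally show "\<bar>f v' q - f v q\<bar> \<le> A * d * exp (\<beta> * q)" by (simp add: ac_simps)
      qed (use A d0 r c in \<open>auto intro!: continuous_intros\<close>)
      ultimately show ?thesis by simp
    qed
    have "\<bar>G v r - G v' r\<bar> \<le> d / 2" if r: "r \<in> {0..\<theta>}" for r
    proof -
      have c: "continuous_on {0..r} (w v)" for v
        by (rule continuous_on_subset[OF cont_w]) (use r in auto)
      have "\<bar>integral {0..r} (\<lambda>q. w v q - w v' q)\<bar> \<le> A * d / \<beta> / \<beta> * exp (\<beta> * r)"
        by (rule abs_integral_le_exp[OF \<beta>(1)])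
           (use A d0 r c w_le \<beta> in \<open>auto intro!: continuous_intros\<close>)
      also have "A * d / \<beta> / \<beta> = d / 2" using \<beta> A by (simp add: field_simps)
      also have "integral {0..r} (\<lambda>q. w v q - w v' q) = integral {0..r} (w v) - integral {0..r} (w v')"
        by (intro integral_diff integrable_continuous_interval c)
      finally have "exp (- \<beta> * r) * \<bar>integral {0..r} (w v) - integral {0..r} (w v')\<bar>
          \<le> exp (- \<beta> * r) * (d / 2 * exp (\<beta> * r))" by (intro mult_left_mono) auto
      then show ?thesis
        by (simp add: G_def abs_mult exp_minus field_simps flip: right_diff_distrib)
    qed
    from this[OF cl(1)[of s]] show "dist (apply_bcontfun (T v) s) (apply_bcontfun (T v') s) \<le> 1/2 * dist v v'"
      by (simp add: T dist_real_def d_def)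
  qed
  obtain v where v: "T v = v" using banach_fix_type[of "1/2" T] lip by auto
  define u where "u s = integral {0..s} (w v)" for s
  have fv: "f v s = \<kappa> s * u s" if "s \<in> {0..\<theta>}" for s
  proof -
    have "apply_bcontfun v s = exp (- \<beta> * s) * u s"
      using T[of v s] that by (simp add: v cl G_def u_def)
    then show ?thesis by (simp add: f_def exp_minus field_simps)
  qed
  have "jacobi_solution \<kappa> \<theta> u"
    unfolding jacobi_solution_def
  proof (intro exI[of _ "w v"] conjI ballI)
    fix s assume s: "s \<in> {0..\<theta>}"
    show "(u has_real_derivative w v s) (at s within {0..\<theta>})"
      unfolding u_def by (rule dI[OF s])
    show "(w v has_real_derivative - (\<kappa> s * u s)) (at s within {0..\<theta>})"
      using dw[OF s, of v] fv[OF s] by simp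
  qed (simp_all add: u_def w_def)
  then show ?thesis by blast
qed

lemma jacobi_solution_gen_sin:
  "\<theta> > 0 \<Longrightarrow> continuous_on {0..\<theta>} \<kappa> \<Longrightarrow> jacobi_solution \<kappa> \<theta> (gen_sin \<kappa> \<theta>)"
  unfolding gen_sin_def using jacobi_solution_exists by (rule someI_ex)

text \<open>The Wronskian \<open>u w\<^sub>1 - u\<^sub>1 w\<close> vanishes at \<open>0\<close> and has the derivative \<open>u w\<^sub>2 - u\<^sub>2 w\<close>.\<close>
lemma sturm_wronskian_le:
  fixes u u1 u2 w w1 w2 :: "real \<Rightarrow> real"
  assumes du: "\<And>s. s \<in> {0..T} \<Longrightarrow> (u has_real_derivative u1 s) (at s within {0..T})"
    and du1: "\<And>s. s \<in> {0..T} \<Longrightarrow> (u1 has_real_derivative u2 s) (at s within {0..T})"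
    and dw: "\<And>s. s \<in> {0..T} \<Longrightarrow> (w has_real_derivative w1 s) (at s within {0..T})"
    and dw1: "\<And>s. s \<in> {0..T} \<Longrightarrow> (w1 has_real_derivative w2 s) (at s within {0..T})"
    and "u 0 = 0" "w 0 = 0"
    and le: "\<And>s. s \<in> {0<..<T} \<Longrightarrow> u2 s * w s \<le> u s * w2 s"
    and s: "s \<in> {0..T}"
  shows "u1 s * w s \<le> u s * w1 s"
proof -
  define F where "F s = u s * w1 s - u1 s * w s" for s
  have dF: "(F has_real_derivative u s * w2 s - u2 s * w s) (at s within {0..T})" if "s \<in> {0..T}" for s
    unfolding F_def
    by (rule DERIV_cong[OF DERIV_diff[OF DERIV_mult[OF du dw1] DERIV_mult[OF du1 dw]]])
       (use that in \<open>auto simp: algebra_simps\<close>)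
  have "F 0 \<le> F s"
  proof (cases "s = 0")
    case False
    then have s': "0 < s" using s by simp
    show ?thesis
    proof (rule DERIV_nonneg_imp_increasing_open[of 0 s F])
      show "continuous_on {0..s} F"
        by (rule continuous_on_subset[OF DERIV_continuous_on[OF dF]]) (use s in auto)
      fix x assume x: "0 < x" "x < s"
      then have xT: "x \<in> {0<..<T}" using s by auto
      then have "at x within {0..T} = at x" by (intro at_within_interior) auto
      then show "\<exists>y. (F has_real_derivative y) (at x) \<and> 0 \<le> y"
        using dF[of x] le[OF xT] xT by (intro exI[of _ "u x * w2 x - u2 x * w x"]) auto
    qed (use s' in simp)
  qed simp
  then show ?thesis by (simp add: F_def assms)
qed

text \<open>The numerator of the derivative of \<open>w/u\<close> is the Wronskian.\<close>
lemma sturm_ratio_le: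
  fixes u u1 u2 w w1 w2 :: "real \<Rightarrow> real"
  assumes du: "\<And>s. s \<in> {0..T} \<Longrightarrow> (u has_real_derivative u1 s) (at s within {0..T})"
    and du1: "\<And>s. s \<in> {0..T} \<Longrightarrow> (u1 has_real_derivative u2 s) (at s within {0..T})"
    and dw: "\<And>s. s \<in> {0..T} \<Longrightarrow> (w has_real_derivative w1 s) (at s within {0..T})"
    and dw1: "\<And>s. s \<in> {0..T} \<Longrightarrow> (w1 has_real_derivative w2 s) (at s within {0..T})"
    and "u 0 = 0" "w 0 = 0"
    and le: "\<And>s. s \<in> {0<..<T} \<Longrightarrow> u2 s * w s \<le> u s * w2 s"
    and pos: "\<And>s. s \<in> {0<..T} \<Longrightarrow> 0 < u s"
    and ab: "0 < a" "a \<le> b" "b \<le> T"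
  shows "w a / u a \<le> w b / u b"
proof (cases "a = b")
  case False
  show ?thesis
  proof (rule DERIV_nonneg_imp_increasing_open[of a b "\<lambda>s. w s / u s"])
    have "continuous_on {0..T} w" "continuous_on {0..T} u"
      using DERIV_continuous_on dw du by blast+
    then have "continuous_on {a..b} w" "continuous_on {a..b} u"
      using ab by (auto elim!: continuous_on_subset)
    then show "continuous_on {a..b} (\<lambda>s. w s / u s)"
      by (rule continuous_on_divide) (metis ab less_irrefl atLeastAtMost_iff greaterThanAtMost_iff
          less_le_trans order_trans pos)
    fix x assume x: "a < x" "x < b"
    then have xT: "x \<in> {0<..<T}" using ab by auto
    then have at: "at x within {0..T} = at x" by (intro at_within_interior) auto
    have "((\<lambda>s. w s / u s) has_real_derivative (w1 x * u x - w x * u1 x) / (u x * u x)) (at x)"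
      using du[of x] dw[of x] pos[of x] xT by (intro DERIV_divide) (auto simp: at)
    moreover have "u1 x * w x \<le> u x * w1 x"
      by (rule sturm_wronskian_le[of T u u1 u2 w w1 w2]) (use assms xT in auto)
    ultimately show "\<exists>y. ((\<lambda>s. w s / u s) has_real_derivative y) (at x) \<and> 0 \<le> y"
      by (intro exI conjI) (auto simp: algebra_simps intro!: divide_nonneg_nonneg)
  qed (use ab in simp)
qed simp

text \<open>Sturm comparison: smaller curvature cannot produce an earlier zero. Up to the first zero of \<open>w\<close> the
quotient \<open>w/u\<close> is nondecreasing, and it is positive close to \<open>0\<close>, hence it cannot reach \<open>0\<close>.\<close>
lemma sturm_positive:
  assumes u: "jacobi_solution \<kappa>' T u" and w: "jacobi_solution \<kappa> T w"
    and le: "\<And>s. s \<in> {0..T} \<Longrightarrow> \<kappa> s \<le> \<kappa>' s"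
    and pos: "\<And>s. s \<in> {0<..T} \<Longrightarrow> 0 < u s"
    and b: "b \<in> {0<..T}"
  shows "0 < w b"
proof (rule ccontr)
  assume nb: "\<not> 0 < w b"
  from w obtain w1 where dw: "\<And>s. s \<in> {0..T} \<Longrightarrow> (w has_real_derivative w1 s) (at s within {0..T})"
    and dw1: "\<And>s. s \<in> {0..T} \<Longrightarrow> (w1 has_real_derivative - (\<kappa> s * w s)) (at s within {0..T})"
    and w0: "w 0 = 0" "w1 0 = 1" unfolding jacobi_solution_def by blast
  from u obtain u1 where du: "\<And>s. s \<in> {0..T} \<Longrightarrow> (u has_real_derivative u1 s) (at s within {0..T})"
    and du1: "\<And>s. s \<in> {0..T} \<Longrightarrow> (u1 has_real_derivative - (\<kappa>' s * u s)) (at s within {0..T})"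
    and u0: "u 0 = 0" unfolding jacobi_solution_def by blast
  have cont_w: "continuous_on {0..T} w" using DERIV_continuous_on dw by blast
  have "\<exists>d>0. \<forall>h>0. 0 + h \<in> {0..T} \<longrightarrow> h < d \<longrightarrow> w 0 < w (0 + h)"
    using dw[of 0] w0 b by (intro has_real_derivative_pos_inc_right[of w 1]) auto
  then obtain d where d: "d > 0" "\<And>h. 0 < h \<Longrightarrow> h \<le> T \<Longrightarrow> h < d \<Longrightarrow> 0 < w h"
    using w0 by auto
  define a where "a = min (d / 2) b"
  have a: "0 < a" "a < d" "a \<le> b" "b \<le> T" using d b by (auto simp: a_def)
  \<comment> \<open>The least element of this compact set is the first zero of \<open>w\<close>.\<close>
  define Z where "Z = {s \<in> {a..b}. w s \<le> 0}"
  have "compact Z"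
  proof -
    have "closed Z" unfolding Z_def
      by (intro continuous_closed_preimage_constant continuous_on_closed_Collect_le
          continuous_on_subset[OF cont_w]) (use a in auto)
    moreover have "bounded Z" unfolding Z_def by (rule bounded_subset[of "{a..b}"]) auto
    ultimately show ?thesis by (simp add: compact_eq_bounded_closed)
  qed
  moreover have "Z \<noteq> {}" using nb a by (auto simp: Z_def)
  ultimately obtain z where z: "z \<in> Z" "\<And>s. s \<in> Z \<Longrightarrow> z \<le> s"
    using compact_attains_inf by metis
  have zr: "a \<le> z" "z \<le> b" "w z \<le> 0" using z by (auto simp: Z_def)
  have wpos: "0 < w s" if "s \<in> {0<..<z}" for s
  proof (cases "s < a")
    case True then show ?thesis using d that a by auto
  next
    case False
    then have "s \<notin> Z" using z(2)[of s] that by auto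
    then show ?thesis using False that zr by (auto simp: Z_def)
  qed
  have sub: "{0..z} \<subseteq> {0..T}" using zr a by auto
  have "w a / u a \<le> w z / u z"
  proof (rule sturm_ratio_le[of z u u1 "\<lambda>s. - (\<kappa>' s * u s)" w w1 "\<lambda>s. - (\<kappa> s * w s)"])
    fix s assume s: "s \<in> {0<..<z}"
    have "\<kappa> s * (u s * w s) \<le> \<kappa>' s * (u s * w s)"
      using le[of s] pos[of s] wpos[OF s] s zr a by (intro mult_right_mono) auto
    then show "- (\<kappa>' s * u s) * w s \<le> u s * - (\<kappa> s * w s)" by (simp add: algebra_simps)
  next
    fix s assume "s \<in> {0..z}"
    then have s: "s \<in> {0..T}" using sub by blast
    note sub = has_field_derivative_subset[OF _ sub]
    show "(u has_real_derivative u1 s) (at s within {0..z})"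
      "(u1 has_real_derivative - (\<kappa>' s * u s)) (at s within {0..z})"
      "(w has_real_derivative w1 s) (at s within {0..z})"
      "(w1 has_real_derivative - (\<kappa> s * w s)) (at s within {0..z})"
      using du[OF s] du1[OF s] dw[OF s] dw1[OF s] by (auto intro: sub)
  qed (use u0 w0 pos a zr in auto)
  moreover have "0 < w a / u a" using d a pos[of a] by auto
  moreover have "w z / u z \<le> 0" using zr pos[of z] a by (auto intro: divide_nonpos_pos)
  ultimately show False by simp
qed

section \<open>Distortion coefficients\<close>

lemma sturm_ratio_solutions:
  assumes u: "jacobi_solution \<kappa>' T u" and w: "jacobi_solution \<kappa> T w"
    and le: "\<And>s. s \<in> {0..T} \<Longrightarrow> \<kappa> s \<le> \<kappa>' s"
    and pos: "\<And>s. s \<in> {0<..T} \<Longrightarrow> 0 < u s"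
    and ab: "0 < a" "a \<le> b" "b \<le> T"
  shows "w a / u a \<le> w b / u b"
proof -
  from w obtain w1 where dw: "\<And>s. s \<in> {0..T} \<Longrightarrow> (w has_real_derivative w1 s) (at s within {0..T})"
    and dw1: "\<And>s. s \<in> {0..T} \<Longrightarrow> (w1 has_real_derivative - (\<kappa> s * w s)) (at s within {0..T})"
    and w0: "w 0 = 0" unfolding jacobi_solution_def by blast
  from u obtain u1 where du: "\<And>s. s \<in> {0..T} \<Longrightarrow> (u has_real_derivative u1 s) (at s within {0..T})"
    and du1: "\<And>s. s \<in> {0..T} \<Longrightarrow> (u1 has_real_derivative - (\<kappa>' s * u s)) (at s within {0..T})"
    and u0: "u 0 = 0" unfolding jacobi_solution_def by blast
  show ?thesis
  proof (rule sturm_ratio_le[OF du du1 dw dw1 u0 w0 _ pos ab])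
    fix s assume s: "s \<in> {0<..<T}"
    have "0 < w s" using sturm_positive[OF u w le pos, of s] s by auto
    then have "\<kappa> s * (u s * w s) \<le> \<kappa>' s * (u s * w s)"
      using le[of s] pos[of s] s by (intro mult_right_mono) auto
    then show "- (\<kappa>' s * u s) * w s \<le> u s * - (\<kappa> s * w s)" by (simp add: algebra_simps)
  qed
qed

lemma sigma_cont_mono:
  assumes \<theta>: "\<theta> > 0" and c: "continuous_on {0..\<theta>} \<kappa>" "continuous_on {0..\<theta>} \<kappa>'"
    and le: "\<And>s. s \<in> {0..\<theta>} \<Longrightarrow> \<kappa> s \<le> \<kappa>' s" and t: "t \<in> {0..1}"
  shows "sigma_cont \<kappa> t \<theta> \<le> sigma_cont \<kappa>' t \<theta>"
proof (cases "\<forall>s\<in>{0<..\<theta>}. gen_sin \<kappa>' \<theta> s > 0")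
  case True
  define u where "u = gen_sin \<kappa>' \<theta>"
  define w where "w = gen_sin \<kappa> \<theta>"
  have u: "jacobi_solution \<kappa>' \<theta> u" and w: "jacobi_solution \<kappa> \<theta> w"
    using jacobi_solution_gen_sin \<theta> c by (auto simp: u_def w_def)
  have up: "\<And>s. s \<in> {0<..\<theta>} \<Longrightarrow> 0 < u s" using True by (auto simp: u_def)
  have wp: "\<And>s. s \<in> {0<..\<theta>} \<Longrightarrow> 0 < w s" by (rule sturm_positive[OF u w le up])
  have "w (t * \<theta>) / w \<theta> \<le> u (t * \<theta>) / u \<theta>"
  proof (cases "t = 0")
    case True
    then show ?thesis using u w by (auto simp: jacobi_solution_def)
  next
    case False
    then have t': "t * \<theta> \<in> {0<..\<theta>}" using t \<theta> by (auto simp: mult_left_le_one_le)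
    have "w (t * \<theta>) / u (t * \<theta>) \<le> w \<theta> / u \<theta>"
      by (rule sturm_ratio_solutions[OF u w le up]) (use t' in auto)
    then show ?thesis
      using up[of \<theta>] wp[of \<theta>] up[OF t'] wp[OF t'] \<theta> by (simp add: field_simps)
  qed
  then show ?thesis
    using True wp by (simp add: sigma_cont_def u_def w_def ennreal_leI)
qed (auto simp: sigma_cont_def)

text \<open>The comparison function \<open>w(s) = s exp(a s)\<close> satisfies \<open>w'' \<ge> a\<^sup>2 w\<close>. Compared with \<open>sinh (a s)\<close> it needs
no separate case \<open>a = 0\<close>, and the quotient \<open>w(t \<theta>) / w(\<theta>)\<close> is at once at least \<open>t exp(-a \<theta>)\<close>.\<close>
lemma sigma_cont_ge:
  assumes \<theta>: "\<theta> > 0" and c: "continuous_on {0..\<theta>} \<kappa>" and "a \<ge> 0"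
    and le: "\<And>s. s \<in> {0..\<theta>} \<Longrightarrow> - a\<^sup>2 \<le> \<kappa> s" and t: "t \<in> {0..1}"
  shows "ennreal (t * exp (- a * \<theta>)) \<le> sigma_cont \<kappa> t \<theta>"
proof (cases "\<forall>s\<in>{0<..\<theta>}. gen_sin \<kappa> \<theta> s > 0")
  case True
  define u where "u = gen_sin \<kappa> \<theta>"
  have "jacobi_solution \<kappa> \<theta> u" using jacobi_solution_gen_sin \<theta> c by (auto simp: u_def)
  then obtain u1 where du: "\<And>s. s \<in> {0..\<theta>} \<Longrightarrow> (u has_real_derivative u1 s) (at s within {0..\<theta>})"
    and du1: "\<And>s. s \<in> {0..\<theta>} \<Longrightarrow> (u1 has_real_derivative - (\<kappa> s * u s)) (at s within {0..\<theta>})"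
    and u0: "u 0 = 0" unfolding jacobi_solution_def by blast
  have up: "\<And>s. s \<in> {0<..\<theta>} \<Longrightarrow> 0 < u s" using True by (auto simp: u_def)
  have "t * exp (- a * \<theta>) \<le> u (t * \<theta>) / u \<theta>"
  proof (cases "t = 0")
    case True
    then show ?thesis using u0 by simp
  next
    case False
    then have t': "t * \<theta> \<in> {0<..\<theta>}" using t \<theta> by (auto simp: mult_left_le_one_le)
    define w where "w s = s * exp (a * s)" for s
    have "w (t * \<theta>) / u (t * \<theta>) \<le> w \<theta> / u \<theta>"
    proof (rule sturm_ratio_le[OF du du1 _ _ u0 _ _ up])
      show "(w has_real_derivative (1 + a * s) * exp (a * s)) (at s within {0..\<theta>})" for s
        unfolding w_def by (auto intro!: derivative_eq_intros simp: algebra_simps)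
      show "((\<lambda>s. (1 + a * s) * exp (a * s)) has_real_derivative (2 * a + a\<^sup>2 * s) * exp (a * s))
              (at s within {0..\<theta>})" for s
        by (auto intro!: derivative_eq_intros simp: algebra_simps power2_eq_square)
      fix s assume s: "s \<in> {0<..<\<theta>}"
      have "- \<kappa> s * (u s * s) \<le> a\<^sup>2 * (u s * s)"
        using le[of s] up[of s] s by (intro mult_right_mono) auto
      also have "\<dots> \<le> u s * (2 * a + a\<^sup>2 * s)"
        using up[of s] s \<open>a \<ge> 0\<close> by (simp add: algebra_simps)
      finally have "(- \<kappa> s * (u s * s)) * exp (a * s) \<le> (u s * (2 * a + a\<^sup>2 * s)) * exp (a * s)"
        by (rule mult_right_mono) simp
      then show "- (\<kappa> s * u s) * w s \<le> u s * ((2 * a + a\<^sup>2 * s) * exp (a * s))"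
        by (simp add: w_def algebra_simps)
    qed (use t' in \<open>auto simp: w_def\<close>)
    then have "w (t * \<theta>) / w \<theta> \<le> u (t * \<theta>) / u \<theta>"
      using up[of \<theta>] up[OF t'] \<theta> by (simp add: field_simps w_def)
    moreover have "t * exp (- a * \<theta>) \<le> w (t * \<theta>) / w \<theta>"
    proof -
      have "1 \<le> exp (a * (t * \<theta>))" using t \<theta> \<open>a \<ge> 0\<close> by simp
      then have "t * exp (- a * \<theta>) * 1 \<le> t * exp (- a * \<theta>) * exp (a * (t * \<theta>))"
        using t by (intro mult_left_mono) auto
      then show ?thesis using \<theta> by (simp add: w_def exp_minus divide_simps)
    qed
    ultimately show ?thesis by simp
  qed
  then show ?thesis
    using True by (simp add: sigma_cont_def u_def ennreal_leI)
qed (auto simp: sigma_cont_def)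

text \<open>The function \<open>w(s) = (s+b)\<^bsup>1/2\<^esup> sin (\<omega> (log (s+b) - log b))\<close> solves \<open>w'' + (1/4 + \<omega>\<^sup>2) (s+b)\<^bsup>-2\<^esup> w = 0\<close> and has
consecutive zeros \<open>0\<close> and \<open>T = b exp(\<pi>/\<omega>) - b\<close>. At \<open>T\<close> the Wronskian inequality reads \<open>0 \<le> u(T) w'(T)\<close>
with \<open>w'(T) < 0\<close>, so the generalized sine \<open>u\<close> cannot stay positive on \<open>(0,T]\<close>.\<close>
lemma sigma_cont_euler_infinite:
  assumes c: "continuous_on {0..\<theta>} \<kappa>" and b: "b > 0" and \<omega>: "\<omega> > 0"
    and le: "\<And>s. s \<in> {0..\<theta>} \<Longrightarrow> (1 / 4 + \<omega>\<^sup>2) / (s + b)\<^sup>2 \<le> \<kappa> s"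
    and \<theta>: "b * exp (pi / \<omega>) - b \<le> \<theta>"
  shows "sigma_cont \<kappa> t \<theta> = \<infinity>"
proof -
  define T where "T = b * exp (pi / \<omega>) - b"
  have T: "0 < T" using b \<omega> by (simp add: T_def)
  have T\<theta>: "T \<le> \<theta>" using \<theta> by (simp add: T_def)
  define u where "u = gen_sin \<kappa> \<theta>"
  have "jacobi_solution \<kappa> \<theta> u" using jacobi_solution_gen_sin T T\<theta> c by (auto simp: u_def)
  then obtain u1 where du: "\<And>s. s \<in> {0..\<theta>} \<Longrightarrow> (u has_real_derivative u1 s) (at s within {0..\<theta>})"
    and du1: "\<And>s. s \<in> {0..\<theta>} \<Longrightarrow> (u1 has_real_derivative - (\<kappa> s * u s)) (at s within {0..\<theta>})"
    and u0: "u 0 = 0" unfolding jacobi_solution_def by blast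
  have sub: "{0..T} \<subseteq> {0..\<theta>}" using T\<theta> by auto
  define \<phi> where "\<phi> s = \<omega> * (ln (s + b) - ln b)" for s
  have \<phi>: "((\<lambda>s. \<phi> s) has_real_derivative \<omega> / (s + b)) (at s within {0..T})" if "s \<in> {0..T}" for s
    unfolding \<phi>_def using that b by (auto intro!: derivative_eq_intros simp: field_simps)
  define w where "w s = sqrt (s + b) * sin (\<phi> s)" for s
  define w1 where "w1 s = (sin (\<phi> s) / 2 + \<omega> * cos (\<phi> s)) / sqrt (s + b)" for s
  define w2 where "w2 s = - ((1 / 4 + \<omega>\<^sup>2) / (s + b)\<^sup>2 * w s)" for s
  have sq: "((\<lambda>s. sqrt (s + b)) has_real_derivative inverse (sqrt (s + b)) / 2) (at s within {0..T})"
    if "s \<in> {0..T}" for s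
    using that b by (auto intro!: derivative_eq_intros simp: field_simps)
  have dsin: "((\<lambda>s. sin (\<phi> s)) has_real_derivative cos (\<phi> s) * (\<omega> / (s + b))) (at s within {0..T})"
    and dcos: "((\<lambda>s. cos (\<phi> s)) has_real_derivative - sin (\<phi> s) * (\<omega> / (s + b))) (at s within {0..T})"
    if "s \<in> {0..T}" for s
    by (rule DERIV_chain2[OF DERIV_sin \<phi>[OF that]] DERIV_chain2[OF DERIV_cos \<phi>[OF that]])+
  have dw: "(w has_real_derivative w1 s) (at s within {0..T})" if s: "s \<in> {0..T}" for s
  proof -
    define r where "r = sqrt (s + b)"
    have r: "r > 0" "s + b = r\<^sup>2" using s b by (auto simp: r_def)
    show ?thesis
      unfolding w_def w1_def
      by (rule DERIV_cong[OF DERIV_mult[OF sq[OF s] dsin[OF s]]])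
         (unfold r_def[symmetric] r(2), use r(1) in \<open>simp add: field_simps power2_eq_square\<close>)
  qed
  have dw1: "(w1 has_real_derivative w2 s) (at s within {0..T})" if s: "s \<in> {0..T}" for s
  proof -
    define r where "r = sqrt (s + b)"
    have r: "r > 0" "s + b = r\<^sup>2" using s b by (auto simp: r_def)
    show ?thesis
      unfolding w1_def w2_def w_def
      by (rule DERIV_cong[OF DERIV_divide[OF DERIV_add[OF DERIV_cdivide[OF dsin[OF s], of 2]
            DERIV_cmult[OF dcos[OF s], of \<omega>]] sq[OF s]]])
         (unfold r_def[symmetric] r(2), use r(1) in \<open>simp_all add: field_simps power2_eq_square\<close>)
  qed
  have "\<not> (\<forall>s\<in>{0<..\<theta>}. u s > 0)"
  proof
    assume "\<forall>s\<in>{0<..\<theta>}. u s > 0"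
    then have up: "\<And>s. s \<in> {0<..\<theta>} \<Longrightarrow> 0 < u s" by blast
    have "u1 T * w T \<le> u T * w1 T"
    proof (rule sturm_wronskian_le[OF _ _ dw dw1])
      fix s assume s: "s \<in> {0..T}"
      then have s': "s \<in> {0..\<theta>}" using sub by blast
      show "(u has_real_derivative u1 s) (at s within {0..T})"
        "(u1 has_real_derivative - (\<kappa> s * u s)) (at s within {0..T})"
        using du[OF s'] du1[OF s'] by (auto intro: has_field_derivative_subset[OF _ sub])
    next
      fix s assume s: "s \<in> {0<..<T}"
      have "ln (s + b) \<le> ln (b * exp (pi / \<omega>))"
        using s b by (intro ln_mono) (auto simp: T_def)
      also have "\<dots> = ln b + pi / \<omega>" using b by (simp add: ln_mult)
      finally have "\<phi> s \<le> pi" using \<omega> by (simp add: \<phi>_def field_simps)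
      moreover have "0 \<le> \<phi> s" using \<omega> s b by (simp add: \<phi>_def)
      ultimately have "0 \<le> w s" using s b by (auto simp: w_def intro!: mult_nonneg_nonneg sin_ge_zero)
      then have "(1 / 4 + \<omega>\<^sup>2) / (s + b)\<^sup>2 * (u s * w s) \<le> \<kappa> s * (u s * w s)"
        using le[of s] up[of s] s T\<theta> by (intro mult_right_mono) auto
      then show "- (\<kappa> s * u s) * w s \<le> u s * w2 s" by (simp add: w2_def algebra_simps)
    qed (use u0 T in \<open>auto simp: w_def \<phi>_def\<close>)
    moreover have "\<phi> T = pi" using b \<omega> by (simp add: \<phi>_def T_def ln_mult)
    then have "w T = 0" "w1 T < 0"
      using T b \<omega> by (auto simp: w_def w1_def intro!: divide_neg_pos)
    moreover have "0 < u T" using up[of T] T T\<theta> by auto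
    ultimately show False using mult_pos_neg[of "u T" "w1 T"] by auto
  qed
  then show ?thesis by (auto simp: sigma_cont_def u_def)
qed

lemma lip_approx_mono:
  assumes "\<And>r. r \<in> {0..\<theta>} \<Longrightarrow> B \<le> \<kappa> r" "\<theta> \<ge> 0" "n \<le> n'"
  shows "lip_approx \<kappa> \<theta> n s \<le> lip_approx \<kappa> \<theta> n' s"
  unfolding lip_approx_def
proof (rule cINF_mono)
  show "bdd_below ((\<lambda>r. \<kappa> r + real n * \<bar>s - r\<bar>) ` {0..\<theta>})"
    using assms(1) by (intro bdd_belowI[of _ B]) (auto intro: add_increasing2)
  show "\<exists>r'\<in>{0..\<theta>}. \<kappa> r' + real n * \<bar>s - r'\<bar> \<le> \<kappa> r + real n' * \<bar>s - r\<bar>" if "r \<in> {0..\<theta>}" for r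
    using that assms(3) by (intro bexI[of _ r]) (auto intro: mult_right_mono)
qed (use assms in auto)

lemma lip_approx_ge:
  assumes "\<And>r. r \<in> {0..\<theta>} \<Longrightarrow> g r \<le> \<kappa> r" "\<theta> \<ge> 0" "s \<in> {0..\<theta>}"
    and "\<And>r. r \<in> {0..\<theta>} \<Longrightarrow> g s \<le> g r + real n * \<bar>s - r\<bar>"
  shows "g s \<le> lip_approx \<kappa> \<theta> n s"
  unfolding lip_approx_def
proof (rule cINF_greatest)
  show "g s \<le> \<kappa> r + real n * \<bar>s - r\<bar>" if "r \<in> {0..\<theta>}" for r
    using assms(1)[OF that] assms(4)[OF that] by linarith
qed (use assms in auto)

lemma lip_approx_lipschitz:
  assumes "\<And>r. r \<in> {0..\<theta>} \<Longrightarrow> B \<le> \<kappa> r" "\<theta> \<ge> 0"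
  shows "lip_approx \<kappa> \<theta> n s \<le> lip_approx \<kappa> \<theta> n s' + real n * \<bar>s - s'\<bar>"
proof -
  have "lip_approx \<kappa> \<theta> n s - real n * \<bar>s - s'\<bar> \<le> lip_approx \<kappa> \<theta> n s'"
    unfolding lip_approx_def[of _ _ _ s']
  proof (rule cINF_greatest)
    fix r assume r: "r \<in> {0..\<theta>}"
    have "lip_approx \<kappa> \<theta> n s \<le> \<kappa> r + real n * \<bar>s - r\<bar>"
      unfolding lip_approx_def using r assms(1)
      by (intro cINF_lower bdd_belowI[of _ B]) (auto intro: add_increasing2)
    also have "\<dots> \<le> \<kappa> r + real n * (\<bar>s - s'\<bar> + \<bar>s' - r\<bar>)"
      by (intro add_left_mono mult_left_mono) auto
    finally show "lip_approx \<kappa> \<theta> n s - real n * \<bar>s - s'\<bar> \<le> \<kappa> r + real n * \<bar>s' - r\<bar>"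
      by (simp add: algebra_simps)
  qed (use assms in auto)
  then show ?thesis by simp
qed

lemma continuous_on_lip_approx:
  assumes "\<And>r. r \<in> {0..\<theta>} \<Longrightarrow> B \<le> \<kappa> r" "\<theta> \<ge> 0"
  shows "continuous_on S (lip_approx \<kappa> \<theta> n)"
proof -
  have "(real n)-lipschitz_on S (lip_approx \<kappa> \<theta> n)"
  proof (rule lipschitz_onI)
    fix s s'
    show "dist (lip_approx \<kappa> \<theta> n s) (lip_approx \<kappa> \<theta> n s') \<le> real n * dist s s'"
      using lip_approx_lipschitz[of \<theta> B \<kappa> n s s'] lip_approx_lipschitz[of \<theta> B \<kappa> n s' s] assms
      by (auto simp: dist_real_def abs_le_iff abs_minus_commute)
  qed simp
  then show ?thesis by (rule lipschitz_on_continuous_on)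
qed

text \<open>The Lipschitz approximations increase, hence so do their coefficients, and the limit in the definition
exists. In particular every single approximation bounds the coefficient from below.\<close>
lemma sigma_coeff_eq_SUP:
  assumes "\<And>r. r \<in> {0..\<theta>} \<Longrightarrow> B \<le> \<kappa> r" "\<theta> > 0" "t \<in> {0..1}"
  shows "sigma_coeff \<kappa> t \<theta> = (SUP n. sigma_cont (lip_approx \<kappa> \<theta> n) t \<theta>)"
proof -
  have "incseq (\<lambda>n. sigma_cont (lip_approx \<kappa> \<theta> n) t \<theta>)"
    by (intro monoI sigma_cont_mono continuous_on_lip_approx[of _ B] lip_approx_mono[of _ B])
       (use assms in auto)
  then have "(\<lambda>n. sigma_cont (lip_approx \<kappa> \<theta> n) t \<theta>) \<longlonglongrightarrow>
      (SUP n. sigma_cont (lip_approx \<kappa> \<theta> n) t \<theta>)" by (rule LIMSEQ_SUP)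
  then show ?thesis using assms(2) by (simp add: sigma_coeff_def limI)
qed

lemma sigma_coeff_ge:
  assumes "\<theta> \<ge> 0" "a \<ge> 0"
    and le: "\<And>s. s \<in> {0..\<theta>} \<Longrightarrow> - a\<^sup>2 \<le> \<kappa> s" and t: "t \<in> {0..1}"
  shows "ennreal (t * exp (- a * \<theta>)) \<le> sigma_coeff \<kappa> t \<theta>"
proof (cases "\<theta> = 0")
  case True
  then show ?thesis by (simp add: sigma_coeff_def)
next
  case False
  then have \<theta>: "\<theta> > 0" using assms by simp
  have "ennreal (t * exp (- a * \<theta>)) \<le> sigma_cont (lip_approx \<kappa> \<theta> 0) t \<theta>"
    by (intro sigma_cont_ge continuous_on_lip_approx[of _ "- a\<^sup>2"] lip_approx_ge[of _ "\<lambda>_. - a\<^sup>2"])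
       (use assms \<theta> in auto)
  also have "\<dots> \<le> sigma_coeff \<kappa> t \<theta>"
  proof -
    have "sigma_coeff \<kappa> t \<theta> = (SUP n. sigma_cont (lip_approx \<kappa> \<theta> n) t \<theta>)"
      by (rule sigma_coeff_eq_SUP) (use le \<theta> t in auto)
    then show ?thesis by (auto intro: SUP_upper2[of 0])
  qed
  finally show ?thesis .
qed

text \<open>The potential \<open>C (s+b)\<^bsup>-2\<^esup>\<close> is Lipschitz on \<open>[0,\<infinity>)\<close>. As soon as \<open>n\<close> exceeds its Lipschitz constant, it lies
below the \<open>n\<close>-th approximation of every function above it, and the case of a continuous potential
applies to that approximation.\<close>
lemma sigma_coeff_euler_infinite:
  assumes "b > 0" "\<omega> > 0"
    and le: "\<And>s. s \<in> {0..\<theta>} \<Longrightarrow> (1 / 4 + \<omega>\<^sup>2) / (s + b)\<^sup>2 \<le> \<kappa> s"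
    and \<theta>: "b * exp (pi / \<omega>) - b \<le> \<theta>" and t: "t \<in> {0..1}"
  shows "sigma_coeff \<kappa> t \<theta> = \<infinity>"
proof -
  have "b * 1 < b * exp (pi / \<omega>)" using assms by (intro mult_strict_left_mono) auto
  then have \<theta>0: "\<theta> > 0" using \<theta> by simp
  define C where "C = 1 / 4 + \<omega>\<^sup>2"
  have C: "C > 0" unfolding C_def by (intro add_pos_nonneg) auto
  define g where "g s = C / (s + b)\<^sup>2" for s
  have g: "g s \<le> \<kappa> s" if "s \<in> {0..\<theta>}" for s using le[OF that] by (simp add: g_def C_def)
  have g0: "0 \<le> \<kappa> s" if "s \<in> {0..\<theta>}" for s
    using C by (intro order_trans[OF _ g[OF that]]) (auto simp: g_def)
  obtain n :: nat where n: "2 * C / b^3 \<le> real n" using real_arch_simple by blast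
  have lip: "g s \<le> g r + real n * \<bar>s - r\<bar>" if s: "s \<in> {0..\<theta>}" and r: "r \<in> {0..\<theta>}" for s r
  proof (cases "r \<le> s")
    case True
    then have "g s \<le> g r" using s r C \<open>b > 0\<close>
      unfolding g_def by (intro divide_left_mono power_mono) auto
    then show ?thesis using n by (auto intro: add_increasing2)
  next
    case False
    define x where "x = s + b" define h where "h = r - s"
    have x: "x \<ge> b" "h > 0" "x > 0" using s False \<open>b > 0\<close> by (auto simp: x_def h_def)
    have r_eq: "r + b = x + h" by (simp add: x_def h_def)
    have "g s - g r = C * ((x + h)\<^sup>2 - x\<^sup>2) / (x\<^sup>2 * (x + h)\<^sup>2)"
      unfolding g_def r_eq x_def[symmetric] using x by (simp add: field_simps)
    also have "\<dots> \<le> C * (2 * h * (x + h)) / (x\<^sup>2 * (x + h)\<^sup>2)"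
      using C x by (intro divide_right_mono mult_left_mono) (auto simp: power2_eq_square algebra_simps)
    also have "\<dots> = 2 * C * h / (x\<^sup>2 * (x + h))"
    proof -
      have "C * (2 * h * (x + h)) / (x\<^sup>2 * (x + h)\<^sup>2) = (2 * C * h) * (x + h) / ((x\<^sup>2 * (x + h)) * (x + h))"
        by (simp only: power2_eq_square ac_simps)
      also have "\<dots> = 2 * C * h / (x\<^sup>2 * (x + h))"
        using x by (intro nonzero_mult_divide_mult_cancel_right) simp
      finally show ?thesis .
    qed
    also have "\<dots> \<le> 2 * C * h / (b\<^sup>2 * b)"
      using C x \<open>b > 0\<close> by (intro divide_left_mono mult_mono power_mono) auto
    also have "\<dots> = 2 * C / b^3 * h" by (simp add: eval_nat_numeral)
    also have "\<dots> \<le> real n * h" using n x by (intro mult_right_mono) auto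
    finally show ?thesis using x by (simp add: h_def abs_minus_commute)
  qed
  have "sigma_cont (lip_approx \<kappa> \<theta> n) t \<theta> = \<infinity>"
  proof (rule sigma_cont_euler_infinite[OF _ assms(1,2) _ \<theta>])
    show "continuous_on {0..\<theta>} (lip_approx \<kappa> \<theta> n)"
      by (rule continuous_on_lip_approx[of _ 0]) (use g0 \<theta>0 in auto)
    show "(1 / 4 + \<omega>\<^sup>2) / (s + b)\<^sup>2 \<le> lip_approx \<kappa> \<theta> n s" if "s \<in> {0..\<theta>}" for s
      using lip_approx_ge[of \<theta> g \<kappa> s n] g lip \<theta>0 that by (auto simp: g_def C_def)
  qed
  moreover have "sigma_cont (lip_approx \<kappa> \<theta> n) t \<theta> \<le> sigma_coeff \<kappa> t \<theta>"
  proof -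
    have "sigma_coeff \<kappa> t \<theta> = (SUP n. sigma_cont (lip_approx \<kappa> \<theta> n) t \<theta>)"
      by (rule sigma_coeff_eq_SUP) (use g0 \<theta>0 t in auto)
    then show ?thesis by (auto intro: SUP_upper2[of n])
  qed
  ultimately show ?thesis by (simp add: top.extremum_unique)
qed

section \<open>Couplings and gluing\<close>

lemma AE_fibre_not_null:
  fixes f :: "'b \<Rightarrow> nat"
  assumes [measurable]: "f \<in> measurable P (count_space UNIV)"
  shows "AE x in P. emeasure P {y \<in> space P. f y = f x} \<noteq> 0"
proof -
  have "AE x in P. \<forall>n. f x = n \<longrightarrow> emeasure P {y \<in> space P. f y = n} \<noteq> 0"
    unfolding AE_all_countable
  proof
    fix n
    show "AE x in P. f x = n \<longrightarrow> emeasure P {y \<in> space P. f y = n} \<noteq> 0"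
    proof (cases "emeasure P {y \<in> space P. f y = n} = 0")
      case True
      then have "{x \<in> space P. f x = n} \<in> null_sets P" by (intro null_setsI) auto
      then show ?thesis by (rule AE_I') auto
    qed simp
  qed
  then show ?thesis by (rule AE_mp) auto
qed

text \<open>Given the label \<open>n\<close> of the common piece, the two components are made independent: with
\<open>q\<^sub>n = P(f = n) = Q(g = n)\<close>, the glued measure has density \<open>1/q\<^sub>n\<close> on \<open>{f = n} \<times> {g = n}\<close> with respect to the
product. For a countable partition this is elementary and avoids conditional probabilities.\<close>
lemma glue_along_countable_partition:
  fixes P :: "'b measure" and Q :: "'c measure" and f :: "'b \<Rightarrow> nat" and g :: "'c \<Rightarrow> nat"
  assumes "prob_space P" "prob_space Q"
    and f[measurable]: "f \<in> measurable P (count_space UNIV)"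
    and g[measurable]: "g \<in> measurable Q (count_space UNIV)"
    and eq: "\<And>n. emeasure P {x \<in> space P. f x = n} = emeasure Q {y \<in> space Q. g y = n}"
  obtains M where "sets M = sets (P \<Otimes>\<^sub>M Q)" "distr M P fst = P" "distr M Q snd = Q"
    "AE z in M. f (fst z) = g (snd z)"
proof -
  interpret P: prob_space P by fact
  interpret Q: prob_space Q by fact
  interpret PQ: pair_sigma_finite P Q ..
  define q where "q n = emeasure P {x \<in> space P. f x = n}" for n
  have qQ: "q n = emeasure Q {y \<in> space Q. g y = n}" for n using eq by (simp add: q_def)
  have q_fin: "q n < top" for n by (simp add: q_def less_top[symmetric])
  have q_inv: "inverse (q n) * q n = 1" if "q n \<noteq> 0" for n
    using ennreal_divide_self[OF that] q_fin[of n] by (simp add: divide_ennreal_def mult.commute)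
  define h where "h z = (if f (fst z) = g (snd z) then inverse (q (f (fst z))) else 0)" for z
  have [measurable]: "(\<lambda>z. inverse (q (f (fst z)))) \<in> borel_measurable (P \<Otimes>\<^sub>M Q)"
    by (rule measurable_compose[OF measurable_compose[OF measurable_fst f]]) simp
  have "Measurable.pred (P \<Otimes>\<^sub>M Q) (\<lambda>z. \<exists>n. f (fst z) = n \<and> g (snd z) = n)"
    by measurable
  then have [measurable]: "Measurable.pred (P \<Otimes>\<^sub>M Q) (\<lambda>z. f (fst z) = g (snd z))"
    by (simp add: eq_commute)
  have h[measurable]: "h \<in> borel_measurable (P \<Otimes>\<^sub>M Q)"
    unfolding h_def by measurable
  define M where "M = density (P \<Otimes>\<^sub>M Q) h"
  have setsM[simp, measurable_cong]: "sets M = sets (P \<Otimes>\<^sub>M Q)" by (simp add: M_def)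
  have pos: "AE x in P. q (f x) \<noteq> 0"
    unfolding q_def by (rule AE_fibre_not_null) simp
  have posQ: "AE y in Q. q (g y) \<noteq> 0"
    unfolding qQ by (rule AE_fibre_not_null) simp
  have hQ: "(\<integral>\<^sup>+ y. h (x, y) \<partial>Q) = inverse (q (f x)) * q (f x)" if "x \<in> space P" for x
  proof -
    have "(\<integral>\<^sup>+ y. h (x, y) \<partial>Q) = (\<integral>\<^sup>+ y. inverse (q (f x)) * indicator {y \<in> space Q. g y = f x} y \<partial>Q)"
      by (intro nn_integral_cong) (auto simp: h_def split: split_indicator)
    also have "\<dots> = inverse (q (f x)) * q (f x)"
      by (subst nn_integral_cmult_indicator) (auto simp: qQ)
    finally show ?thesis .
  qed
  have hP: "(\<integral>\<^sup>+ x. h (x, y) \<partial>P) = inverse (q (g y)) * q (g y)" if "y \<in> space Q" for y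
  proof -
    have "(\<integral>\<^sup>+ x. h (x, y) \<partial>P) = (\<integral>\<^sup>+ x. inverse (q (g y)) * indicator {x \<in> space P. f x = g y} x \<partial>P)"
      by (intro nn_integral_cong) (auto simp: h_def split: split_indicator)
    also have "\<dots> = inverse (q (g y)) * q (g y)"
      by (subst nn_integral_cmult_indicator) (auto simp: q_def)
    finally show ?thesis .
  qed
  show thesis
  proof (rule that[of M])
    show "distr M P fst = P"
    proof (rule measure_eqI)
      fix A assume "A \<in> sets (distr M P fst)"
      then have A[measurable]: "A \<in> sets P" by simp
      have "emeasure (distr M P fst) A = emeasure M (fst -` A \<inter> space M)"
        by (rule emeasure_distr) (auto simp: M_def)
      also have "\<dots> = (\<integral>\<^sup>+ z. h z * indicator A (fst z) \<partial>(P \<Otimes>\<^sub>M Q))"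
      proof -
        have [measurable]: "fst -` A \<inter> space M \<in> sets (P \<Otimes>\<^sub>M Q)"
          using measurable_sets[OF measurable_fst A, of Q] by (simp add: M_def)
        show ?thesis unfolding M_def
          by (subst emeasure_density)
             (use measurable_sets[OF measurable_fst A, of Q] in
               \<open>auto intro!: nn_integral_cong split: split_indicator\<close>)
      qed
      also have "\<dots> = (\<integral>\<^sup>+ x. \<integral>\<^sup>+ y. h (x, y) * indicator A x \<partial>Q \<partial>P)"
        by (subst Q.nn_integral_fst[symmetric]) auto
      also have "\<dots> = (\<integral>\<^sup>+ x. (\<integral>\<^sup>+ y. h (x, y) \<partial>Q) * indicator A x \<partial>P)"
        by (intro nn_integral_cong nn_integral_multc) measurable
      also have "\<dots> = (\<integral>\<^sup>+ x. indicator A x \<partial>P)"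
        using pos by (intro nn_integral_cong_AE) (auto simp: hQ q_inv)
      finally show "emeasure (distr M P fst) A = emeasure P A" by simp
    qed simp
    show "distr M Q snd = Q"
    proof (rule measure_eqI)
      fix A assume "A \<in> sets (distr M Q snd)"
      then have A[measurable]: "A \<in> sets Q" by simp
      have "emeasure (distr M Q snd) A = emeasure M (snd -` A \<inter> space M)"
        by (rule emeasure_distr) (auto simp: M_def)
      also have "\<dots> = (\<integral>\<^sup>+ z. h z * indicator A (snd z) \<partial>(P \<Otimes>\<^sub>M Q))"
        unfolding M_def
        by (subst emeasure_density)
           (use measurable_sets[OF measurable_snd A, of P] in
             \<open>auto intro!: nn_integral_cong split: split_indicator\<close>)
      also have "\<dots> = (\<integral>\<^sup>+ y. \<integral>\<^sup>+ x. h (x, y) * indicator A y \<partial>P \<partial>Q)"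
        by (subst PQ.nn_integral_snd[symmetric]) auto
      also have "\<dots> = (\<integral>\<^sup>+ y. (\<integral>\<^sup>+ x. h (x, y) \<partial>P) * indicator A y \<partial>Q)"
        by (intro nn_integral_cong nn_integral_multc) measurable
      also have "\<dots> = (\<integral>\<^sup>+ y. indicator A y \<partial>Q)"
        using posQ by (intro nn_integral_cong_AE) (auto simp: hP q_inv)
      finally show "emeasure (distr M Q snd) A = emeasure Q A" by simp
    qed simp
    show "AE z in M. f (fst z) = g (snd z)"
      unfolding M_def by (subst AE_density) (auto simp: h_def)
  qed (simp add: M_def)
qed

lemma countable_fine_partition:
  assumes "\<eta> > 0"
  obtains idx :: "'a::polish_space \<Rightarrow> nat" where "idx \<in> measurable borel (count_space UNIV)"
    "\<And>x y. idx x = idx y \<Longrightarrow> dist x y < \<eta>"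
proof -
  obtain D :: "'a set" where D: "countable D" "\<And>X. open X \<Longrightarrow> X \<noteq> {} \<Longrightarrow> \<exists>d\<in>D. d \<in> X"
    using countable_dense_setE by blast
  define d where "d = from_nat_into D"
  define idx where "idx x = (LEAST n. dist x (d n) < \<eta> / 2)" for x
  have near: "dist x (d (idx x)) < \<eta> / 2" for x
  proof -
    obtain e where e: "e \<in> D" "e \<in> ball x (\<eta> / 2)"
      using D(2)[of "ball x (\<eta> / 2)"] assms by auto
    then obtain n where "d n = e" using from_nat_into_surj[OF D(1)] by (auto simp: d_def)
    then have "dist x (d n) < \<eta> / 2" using e by simp
    then show ?thesis unfolding idx_def by (rule LeastI)
  qed
  show thesis
  proof
    show "idx \<in> measurable borel (count_space UNIV)" unfolding idx_def by measurable
    show "dist x y < \<eta>" if "idx x = idx y" for x y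
      using near[of x] near[of y] that dist_triangle2[of x y "d (idx x)"] by simp
  qed
qed

lemma borel_pair: "(borel :: ('a::polish_space \<times> 'b::polish_space) measure) = borel \<Otimes>\<^sub>M borel"
  by (rule borel_prod[symmetric])

lemma couplingsD:
  assumes "\<pi> \<in> couplings \<mu> \<nu>"
  shows "sets \<pi> = sets borel" "prob_space \<pi>" "distr \<pi> borel fst = \<mu>" "distr \<pi> borel snd = \<nu>"
    "fst \<in> measurable \<pi> borel" "snd \<in> measurable \<pi> borel"
  using assms by (auto simp: couplings_def borel_pair cong: measurable_cong_sets)

lemma AE_couplingD:
  assumes \<pi>: "\<pi> \<in> couplings \<mu> \<nu>" and A: "AE x in \<mu>. P x" and B: "AE y in \<nu>. Q y"
  shows "AE z in \<pi>. P (fst z) \<and> Q (snd z)"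
proof -
  note c = couplingsD[OF \<pi>]
  have "AE z in \<pi>. P (fst z)" by (rule AE_distrD[OF c(5)]) (subst c(3), rule A)
  moreover have "AE z in \<pi>. Q (snd z)" by (rule AE_distrD[OF c(6)]) (subst c(4), rule B)
  ultimately show ?thesis by auto
qed

lemma prod_in_couplings:
  fixes \<mu> \<nu> :: "'a::polish_space measure"
  assumes "\<mu> \<in> P2" "\<nu> \<in> P2"
  shows "\<mu> \<Otimes>\<^sub>M \<nu> \<in> couplings \<mu> \<nu>"
proof -
  have s[measurable_cong]: "sets \<mu> = sets borel" "sets \<nu> = sets borel" and p: "prob_space \<mu>" "prob_space \<nu>"
    using assms by (auto simp: P2_def)
  interpret \<mu>: prob_space \<mu> by fact
  interpret \<nu>: prob_space \<nu> by fact
  interpret pair_prob_space \<mu> \<nu> ..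
  have "distr (\<mu> \<Otimes>\<^sub>M \<nu>) borel fst = \<mu>"
    using \<nu>.distr_pair_fst[of \<mu>] s by (simp cong: distr_cong)
  moreover have "distr (\<mu> \<Otimes>\<^sub>M \<nu>) borel snd = \<nu>"
  proof (rule measure_eqI)
    fix A assume "A \<in> sets (distr (\<mu> \<Otimes>\<^sub>M \<nu>) borel snd)"
    then have A: "A \<in> sets \<nu>" by (simp add: s)
    have "emeasure (distr (\<mu> \<Otimes>\<^sub>M \<nu>) borel snd) A = emeasure (\<mu> \<Otimes>\<^sub>M \<nu>) (space \<mu> \<times> A)"
      using A sets.sets_into_space[OF A]
      by (subst emeasure_distr) (auto simp: s space_pair_measure intro!: arg_cong2[of _ _ _ _ emeasure])
    also have "\<dots> = emeasure \<nu> A"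
      using A \<mu>.emeasure_space_1 by (simp add: \<nu>.emeasure_pair_measure_Times)
    finally show "emeasure (distr (\<mu> \<Otimes>\<^sub>M \<nu>) borel snd) A = emeasure \<nu> A" .
  qed (simp add: s)
  moreover have "sets (\<mu> \<Otimes>\<^sub>M \<nu>) = sets borel"
    unfolding borel_pair by (rule sets_pair_measure_cong) (auto simp: s)
  ultimately show ?thesis by (simp add: couplings_def prob_space_axioms)
qed

lemma dist_sq_le: "(dist x y)\<^sup>2 \<le> 2 * (dist x z)\<^sup>2 + 2 * (dist z y)\<^sup>2" for x y z :: "'a::metric_space"
proof -
  have "(dist x y)\<^sup>2 \<le> (dist x z + dist z y)\<^sup>2" by (intro power_mono dist_triangle) simp
  also have "\<dots> \<le> 2 * (dist x z)\<^sup>2 + 2 * (dist z y)\<^sup>2"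
    using sum_squares_bound[of "dist x z" "dist z y"] by (simp add: power2_sum)
  finally show ?thesis .
qed

lemma ennreal_dist_sq_le:
  fixes x y z :: "'a::metric_space"
  shows "ennreal ((dist x y)\<^sup>2) \<le> 2 * ennreal ((dist x z)\<^sup>2) + 2 * ennreal ((dist z y)\<^sup>2)"
proof -
  have "ennreal ((dist x y)\<^sup>2) \<le> ennreal (2 * (dist x z)\<^sup>2 + 2 * (dist z y)\<^sup>2)"
    by (intro ennreal_leI dist_sq_le)
  also have "\<dots> = 2 * ennreal ((dist x z)\<^sup>2) + 2 * ennreal ((dist z y)\<^sup>2)"
    by (subst ennreal_plus) (simp_all add: ennreal_mult')
  finally show ?thesis .
qed

lemma P2_second_moment:
  fixes \<mu> :: "'a::polish_space measure"
  assumes "\<mu> \<in> P2"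
  shows "(\<integral>\<^sup>+ x. ennreal ((dist a x)\<^sup>2) \<partial>\<mu>) < \<infinity>"
proof -
  have [measurable_cong]: "sets \<mu> = sets borel" using assms by (simp add: P2_def)
  obtain x0 where x0: "(\<integral>\<^sup>+ x. ennreal ((dist x0 x)\<^sup>2) \<partial>\<mu>) < \<infinity>" and p: "prob_space \<mu>"
    using assms by (auto simp: P2_def)
  interpret prob_space \<mu> by fact
  have "(\<integral>\<^sup>+ x. ennreal ((dist a x)\<^sup>2) \<partial>\<mu>)
      \<le> (\<integral>\<^sup>+ x. 2 * ennreal ((dist a x0)\<^sup>2) + 2 * ennreal ((dist x0 x)\<^sup>2) \<partial>\<mu>)"
    by (intro nn_integral_mono ennreal_dist_sq_le)
  also have "\<dots> = 2 * ennreal ((dist a x0)\<^sup>2) + 2 * (\<integral>\<^sup>+ x. ennreal ((dist x0 x)\<^sup>2) \<partial>\<mu>)"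
    by (simp add: nn_integral_add nn_integral_cmult emeasure_space_1)
  also have "\<dots> < \<infinity>" using x0 by (simp add: ennreal_mult_less_top)
  finally show ?thesis .
qed

lemma transport_cost_finite:
  fixes \<mu> \<nu> :: "'a::polish_space measure"
  assumes "\<mu> \<in> P2" "\<nu> \<in> P2" and \<pi>: "\<pi> \<in> couplings \<mu> \<nu>"
  shows "transport_cost \<pi> < \<infinity>"
proof -
  note c = couplingsD[OF \<pi>]
  note [measurable_cong] = c(1)[unfolded borel_pair]
  have [measurable_cong]: "sets \<mu> = sets borel" "sets \<nu> = sets borel"
    using assms by (auto simp: P2_def)
  obtain a :: 'a where True by blast
  have "transport_cost \<pi> \<le> (\<integral>\<^sup>+ z. 2 * ennreal ((dist a (fst z))\<^sup>2) + 2 * ennreal ((dist a (snd z))\<^sup>2) \<partial>\<pi>)"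
    unfolding transport_cost_def
    by (intro nn_integral_mono) (metis ennreal_dist_sq_le dist_commute)
  also have "\<dots> = 2 * (\<integral>\<^sup>+ z. ennreal ((dist a (fst z))\<^sup>2) \<partial>\<pi>) + 2 * (\<integral>\<^sup>+ z. ennreal ((dist a (snd z))\<^sup>2) \<partial>\<pi>)"
    by (simp add: nn_integral_add nn_integral_cmult)
  also have "(\<integral>\<^sup>+ z. ennreal ((dist a (fst z))\<^sup>2) \<partial>\<pi>) = (\<integral>\<^sup>+ x. ennreal ((dist a x)\<^sup>2) \<partial>\<mu>)"
    unfolding c(3)[symmetric] by (subst nn_integral_distr) (auto simp: c)
  also have "(\<integral>\<^sup>+ z. ennreal ((dist a (snd z))\<^sup>2) \<partial>\<pi>) = (\<integral>\<^sup>+ x. ennreal ((dist a x)\<^sup>2) \<partial>\<nu>)"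
    unfolding c(4)[symmetric] by (subst nn_integral_distr) (auto simp: c)
  also have "2 * (\<integral>\<^sup>+ x. ennreal ((dist a x)\<^sup>2) \<partial>\<mu>) + 2 * (\<integral>\<^sup>+ x. ennreal ((dist a x)\<^sup>2) \<partial>\<nu>) < \<infinity>"
    using P2_second_moment[OF assms(1), of a] P2_second_moment[OF assms(2), of a]
    by (simp add: ennreal_mult_less_top)
  finally show ?thesis .
qed

text \<open>Finite second moments make the infimum finite, so the passage to real numbers in the definition of
the distance loses nothing.\<close>
lemma W2_sq:
  fixes \<mu> \<nu> :: "'a::polish_space measure"
  assumes "\<mu> \<in> P2" "\<nu> \<in> P2"
  shows "ennreal ((W2 \<mu> \<nu>)\<^sup>2) = (INF \<pi> \<in> couplings \<mu> \<nu>. transport_cost \<pi>)"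
proof -
  have "(INF \<pi> \<in> couplings \<mu> \<nu>. transport_cost \<pi>) \<le> transport_cost (\<mu> \<Otimes>\<^sub>M \<nu>)"
    by (intro INF_lower prod_in_couplings assms)
  also have "\<dots> < \<infinity>" by (intro transport_cost_finite[OF assms] prod_in_couplings assms)
  finally show ?thesis by (simp add: W2_def)
qed

lemma W2_le_cost:
  fixes \<mu> \<nu> :: "'a::polish_space measure"
  assumes "\<mu> \<in> P2" "\<nu> \<in> P2" "\<pi> \<in> couplings \<mu> \<nu>"
  shows "ennreal ((W2 \<mu> \<nu>)\<^sup>2) \<le> transport_cost \<pi>"
  unfolding W2_sq[OF assms(1,2)] by (intro INF_lower assms)

lemma near_optimal_coupling:
  fixes \<mu> \<nu> :: "'a::polish_space measure"
  assumes "\<mu> \<in> P2" "\<nu> \<in> P2" "\<eta> > 0"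
  obtains \<pi> where "\<pi> \<in> couplings \<mu> \<nu>" "transport_cost \<pi> \<le> ennreal ((W2 \<mu> \<nu>)\<^sup>2 + \<eta>)"
proof -
  have "(INF \<pi> \<in> couplings \<mu> \<nu>. transport_cost \<pi>) < ennreal ((W2 \<mu> \<nu>)\<^sup>2 + \<eta>)"
    unfolding W2_sq[OF assms(1,2), symmetric] using assms(3) by (intro ennreal_lessI) (auto intro: add_nonneg_pos)
  then show thesis using that by (auto simp: INF_less_iff less_imp_le)
qed

section \<open>Intermediate measures of Wasserstein geodesics\<close>

text \<open>Convexity of the square. With \<open>a = d(x,z)\<close> and \<open>b = d(z,y)\<close> it gives
\<open>d(x,y)\<^sup>2 \<le> d(x,z)\<^sup>2/t + d(z,y)\<^sup>2/(1-t)\<close>, and along a geodesic from \<open>x\<close> to \<open>y\<close> the point \<open>z\<close> at time \<open>t\<close> is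
where equality holds.\<close>
lemma square_sum_le_weighted:
  fixes a b t :: real
  assumes "0 < t" "t < 1"
  shows "(a + b)\<^sup>2 \<le> a\<^sup>2 / t + b\<^sup>2 / (1 - t)"
proof -
  have "a\<^sup>2 / t + b\<^sup>2 / (1 - t) - (a + b)\<^sup>2 = ((1 - t) * a - t * b)\<^sup>2 / (t * (1 - t))"
    using assms by (simp add: field_simps power2_eq_square)
  also have "\<dots> \<ge> 0" using assms by auto
  finally show ?thesis by simp
qed

lemma ennreal_affine_combination:
  assumes "0 \<le> a" "0 \<le> b" "0 \<le> c" "0 \<le> x" "0 \<le> y"
  shows "ennreal a * ennreal x + (ennreal b * ennreal y + ennreal c) = ennreal (a * x + (b * y + c))"
  using assms by (simp add: ennreal_mult)

text \<open>Glue nearly optimal couplings into a law of points \<open>x, z, y\<close>. Integrating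
\<open>d(x,y)\<^sup>2 \<le> d(x,z)\<^sup>2/t + d(z,y)\<^sup>2/(1-t)\<close> gives at least \<open>W\<^sup>2\<close> on the left and, up to a small error,
\<open>t W\<^sup>2 + (1-t) W\<^sup>2\<close> on the right, so there is no room for a gap between the two sides. As \<open>d(x,y) \<le> L\<close>, at a point \<open>z\<close> with
\<open>d(x,z)\<^sup>2 \<ge> t (L\<^sup>2 + \<alpha>)\<close> for all \<open>x\<close> in \<open>A0\<close> the gap would be at least \<open>\<alpha>\<close>; hence such points form a null set.\<close>
lemma W2_geodesic_concentration:
  fixes \<nu>0 \<nu>t \<nu>1 :: "'a::polish_space measure"
  assumes P2: "\<nu>0 \<in> P2" "\<nu>t \<in> P2" "\<nu>1 \<in> P2" and t: "0 < t" "t < 1"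
    and W0: "W2 \<nu>0 \<nu>t = t * W2 \<nu>0 \<nu>1" and W1: "W2 \<nu>t \<nu>1 = (1 - t) * W2 \<nu>0 \<nu>1"
    and A0: "AE x in \<nu>0. x \<in> A0" and A1: "AE y in \<nu>1. y \<in> A1"
    and L: "\<And>x y. x \<in> A0 \<Longrightarrow> y \<in> A1 \<Longrightarrow> dist x y \<le> L" and \<alpha>: "\<alpha> > 0"
  shows "AE z in \<nu>t. \<exists>x\<in>A0. (dist x z)\<^sup>2 < t * (L\<^sup>2 + \<alpha>)"
proof -
  define W where "W = W2 \<nu>0 \<nu>1"
  define Bad where "Bad = {z. \<forall>x\<in>A0. t * (L\<^sup>2 + \<alpha>) \<le> (dist x z)\<^sup>2}"
  have "closed (\<Inter>x\<in>A0. {z. t * (L\<^sup>2 + \<alpha>) \<le> (dist x z)\<^sup>2})"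
    by (intro closed_INT ballI closed_Collect_le continuous_intros)
  moreover have "Bad = (\<Inter>x\<in>A0. {z. t * (L\<^sup>2 + \<alpha>) \<le> (dist x z)\<^sup>2})" by (auto simp: Bad_def)
  ultimately have Bad[measurable]: "Bad \<in> sets borel" by simp
  have setst[measurable_cong]: "sets \<nu>0 = sets borel" "sets \<nu>t = sets borel" "sets \<nu>1 = sets borel"
    and "prob_space \<nu>t" using P2 by (auto simp: P2_def)
  interpret \<nu>t: prob_space \<nu>t by fact
  have space_t: "space \<nu>t = UNIV" using sets_eq_imp_space_eq[OF setst(2)] by simp
  \<comment> \<open>Bounds the total error in terms of \<open>\<eta>\<close>, which is both the excess cost of the two couplings and the mesh of the partition.\<close>
  define K where "K = 1 / t + W\<^sup>2 + 4 / (1 - t)"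
  have key: "\<alpha> * measure \<nu>t Bad \<le> \<eta> * K" if \<eta>: "0 < \<eta>" "\<eta> < 1" for \<eta>
  proof -
    obtain \<pi>0 where \<pi>0: "\<pi>0 \<in> couplings \<nu>0 \<nu>t" "transport_cost \<pi>0 \<le> ennreal ((t * W)\<^sup>2 + \<eta>)"
      using near_optimal_coupling[OF P2(1,2) \<eta>(1)] unfolding W0 W_def by blast
    obtain \<pi>1 where \<pi>1: "\<pi>1 \<in> couplings \<nu>t \<nu>1" "transport_cost \<pi>1 \<le> ennreal (((1 - t) * W)\<^sup>2 + \<eta>)"
      using near_optimal_coupling[OF P2(2,3) \<eta>(1)] unfolding W1 W_def by blast
    note c0 = couplingsD[OF \<pi>0(1)] and c1 = couplingsD[OF \<pi>1(1)]
    have [measurable_cong]: "sets \<pi>0 = sets (borel \<Otimes>\<^sub>M borel)" "sets \<pi>1 = sets (borel \<Otimes>\<^sub>M borel)"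
      using c0(1) c1(1) by (simp_all add: borel_pair)
    obtain idx :: "'a \<Rightarrow> nat" where idx[measurable]: "idx \<in> measurable borel (count_space UNIV)"
      and near: "\<And>x y. idx x = idx y \<Longrightarrow> dist x y < \<eta>"
      using countable_fine_partition[OF \<eta>(1)] by blast
    have e0: "emeasure \<pi>0 {x \<in> space \<pi>0. idx (snd x) = n} = emeasure \<nu>t {z \<in> space \<nu>t. idx z = n}" for n
    proof -
      have "{z. idx z = n} \<in> sets borel" using measurable_sets[OF idx, of "{n}"] by (simp add: vimage_def)
      then show ?thesis
        unfolding c0(4)[symmetric] by (subst emeasure_distr) (auto simp: c0 space_t intro!: arg_cong2[of _ _ _ _ emeasure])
    qed
    have e1: "emeasure \<pi>1 {x \<in> space \<pi>1. idx (fst x) = n} = emeasure \<nu>t {z \<in> space \<nu>t. idx z = n}" for n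
    proof -
      have "{z. idx z = n} \<in> sets borel" using measurable_sets[OF idx, of "{n}"] by (simp add: vimage_def)
      then show ?thesis
        unfolding c1(3)[symmetric] by (subst emeasure_distr) (auto simp: c1 space_t intro!: arg_cong2[of _ _ _ _ emeasure])
    qed
    obtain M where M: "sets M = sets (\<pi>0 \<Otimes>\<^sub>M \<pi>1)" "distr M \<pi>0 fst = \<pi>0" "distr M \<pi>1 snd = \<pi>1"
      and M_idx: "AE w in M. idx (snd (fst w)) = idx (fst (snd w))"
      by (rule glue_along_countable_partition[of \<pi>0 \<pi>1 "\<lambda>w. idx (snd w)" "\<lambda>w. idx (fst w)"])
         (use c0 c1 e0 e1 in auto)
    note [measurable_cong] = M(1)
    have fM: "fst \<in> measurable M \<pi>0" and sM: "snd \<in> measurable M \<pi>1"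
      using M(1) by (auto cong: measurable_cong_sets)
    have "prob_space M" using prob_space_distrD[OF fM] M(2) c0(2) by simp
    then interpret M: prob_space M .
    define g where "g w = (fst (fst w), snd (snd w))" for w :: "('a \<times> 'a) \<times> ('a \<times> 'a)"
    have g[measurable]: "g \<in> measurable M borel" unfolding g_def[abs_def] borel_pair by measurable
    have prj: "fst \<in> measurable (borel :: ('a \<times> 'a) measure) borel"
        "snd \<in> measurable (borel :: ('a \<times> 'a) measure) borel"
      unfolding borel_pair by simp_all
    have "distr M borel g \<in> couplings \<nu>0 \<nu>1"
      unfolding couplings_def
    proof (intro CollectI conjI)
      show "prob_space (distr M borel g)" by (rule M.prob_space_distr[OF g])
      have "distr (distr M borel g) borel fst = distr M borel (\<lambda>w. fst (fst w))"
        by (subst distr_distr[OF prj(1) g]) (simp add: o_def g_def)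
      also have "\<dots> = distr (distr M \<pi>0 fst) borel fst"
        by (subst distr_distr[OF c0(5) fM]) (simp add: o_def)
      also have "\<dots> = \<nu>0" by (simp add: M c0)
      finally show "distr (distr M borel g) borel fst = \<nu>0" .
      have "distr (distr M borel g) borel snd = distr M borel (\<lambda>w. snd (snd w))"
        by (subst distr_distr[OF prj(2) g]) (simp add: o_def g_def)
      also have "\<dots> = distr (distr M \<pi>1 snd) borel snd"
        by (subst distr_distr[OF c1(6) sM]) (simp add: o_def)
      also have "\<dots> = \<nu>1" by (simp add: M c1)
      finally show "distr (distr M borel g) borel snd = \<nu>1" .
    qed simp
    then have "ennreal (W\<^sup>2) \<le> transport_cost (distr M borel g)"
      unfolding W_def by (intro W2_le_cost P2)
    also have "\<dots> = (\<integral>\<^sup>+ w. ennreal ((dist (fst (fst w)) (snd (snd w)))\<^sup>2) \<partial>M)"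
      unfolding transport_cost_def by (subst nn_integral_distr[OF g]) (auto simp: g_def borel_pair)
    finally have W_le: "ennreal (W\<^sup>2) \<le> (\<integral>\<^sup>+ w. ennreal ((dist (fst (fst w)) (snd (snd w)))\<^sup>2) \<partial>M)" .
    have cost0: "(\<integral>\<^sup>+ w. ennreal ((dist (fst (fst w)) (snd (fst w)))\<^sup>2) \<partial>M) = transport_cost \<pi>0"
    proof -
      have "transport_cost \<pi>0 = (\<integral>\<^sup>+ z. ennreal ((dist (fst z) (snd z))\<^sup>2) \<partial>distr M \<pi>0 fst)"
        by (simp add: transport_cost_def M)
      then show ?thesis by (subst (asm) nn_integral_distr[OF fM]) auto
    qed
    have cost1: "(\<integral>\<^sup>+ w. ennreal ((dist (fst (snd w)) (snd (snd w)))\<^sup>2) \<partial>M) = transport_cost \<pi>1"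
    proof -
      have "transport_cost \<pi>1 = (\<integral>\<^sup>+ z. ennreal ((dist (fst z) (snd z))\<^sup>2) \<partial>distr M \<pi>1 snd)"
        by (simp add: transport_cost_def M)
      then show ?thesis by (subst (asm) nn_integral_distr[OF sM]) auto
    qed
    have bad: "(\<integral>\<^sup>+ w. indicator Bad (snd (fst w)) \<partial>M) = emeasure \<nu>t Bad"
    proof -
      have "emeasure \<nu>t Bad = (\<integral>\<^sup>+ z. indicator Bad z \<partial>distr \<pi>0 borel snd)"
        using Bad by (simp add: c0(4) setst)
      also have "\<dots> = (\<integral>\<^sup>+ w. indicator Bad (snd w) \<partial>distr M \<pi>0 fst)"
        by (subst nn_integral_distr) (auto simp: c0 M)
      also have "\<dots> = (\<integral>\<^sup>+ w. indicator Bad (snd (fst w)) \<partial>M)"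
        by (subst nn_integral_distr[OF fM]) auto
      finally show ?thesis ..
    qed
    define c where "c = (1 + \<eta>) / (1 - t)" define e where "e = 2 * \<eta> / (1 - t)"
    have ce: "c \<ge> 0" "e \<ge> 0" using \<eta> t by (auto simp: c_def e_def)
    have "AE w in M. fst (fst w) \<in> A0"
      by (rule AE_distrD[OF fM], subst M(2)) (use AE_couplingD[OF \<pi>0(1) A0, of "\<lambda>_. True"] in simp)
    moreover have "AE w in M. snd (snd w) \<in> A1"
      by (rule AE_distrD[OF sM], subst M(3)) (use AE_couplingD[OF \<pi>1(1) _ A1, of "\<lambda>_. True"] in simp)
    ultimately have "AE w in M. ennreal ((dist (fst (fst w)) (snd (snd w)))\<^sup>2) + ennreal \<alpha> * indicator Bad (snd (fst w))
        \<le> ennreal (1 / t) * ennreal ((dist (fst (fst w)) (snd (fst w)))\<^sup>2)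
          + (ennreal c * ennreal ((dist (fst (snd w)) (snd (snd w)))\<^sup>2) + ennreal e)"
      using M_idx
    proof eventually_elim
      case (elim w)
      define x where "x = fst (fst w)" define z where "z = snd (fst w)"
      define z' where "z' = fst (snd w)" define y where "y = snd (snd w)"
      have xy: "x \<in> A0" "y \<in> A1" "dist z z' < \<eta>"
        using elim near by (auto simp: x_def y_def z_def z'_def)
      have D: "(dist x y)\<^sup>2 \<le> L\<^sup>2" using L[OF xy(1,2)] by (intro power_mono) auto
      have ce': "0 \<le> c * (dist z' y)\<^sup>2 + e" using ce by simp
      have "(dist x y)\<^sup>2 + \<alpha> * indicator Bad z \<le> (dist x z)\<^sup>2 / t + (c * (dist z' y)\<^sup>2 + e)"
      proof (cases "z \<in> Bad")
        case True
        then have "L\<^sup>2 + \<alpha> \<le> (dist x z)\<^sup>2 / t" using xy t by (auto simp: Bad_def field_simps)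
        then show ?thesis using D ce' True by simp
      next
        case False
        have "dist x y \<le> dist x z + (dist z' y + \<eta>)"
          using dist_triangle[of x y z] dist_triangle[of z y z'] xy by simp
        then have "(dist x y)\<^sup>2 \<le> (dist x z + (dist z' y + \<eta>))\<^sup>2" by (intro power_mono) auto
        also have "\<dots> \<le> (dist x z)\<^sup>2 / t + (dist z' y + \<eta>)\<^sup>2 / (1 - t)"
          by (rule square_sum_le_weighted[OF t])
        also have "(dist z' y + \<eta>)\<^sup>2 / (1 - t) \<le> ((1 + \<eta>) * (dist z' y)\<^sup>2 + 2 * \<eta>) / (1 - t)"
        proof (intro divide_right_mono)
          have "\<eta> * (2 * dist z' y) \<le> \<eta> * ((dist z' y)\<^sup>2 + 1)"
            using sum_squares_bound[of "dist z' y" 1] \<eta> by (intro mult_left_mono) auto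
          moreover have "\<eta> * \<eta> \<le> \<eta> * 1" using \<eta> by (intro mult_left_mono) auto
          ultimately show "(dist z' y + \<eta>)\<^sup>2 \<le> (1 + \<eta>) * (dist z' y)\<^sup>2 + 2 * \<eta>"
            by (simp add: power2_sum power2_eq_square algebra_simps)
        qed (use t in simp)
        also have "((1 + \<eta>) * (dist z' y)\<^sup>2 + 2 * \<eta>) / (1 - t) = c * (dist z' y)\<^sup>2 + e"
          unfolding c_def e_def
          by (simp only: add_divide_distrib[of "(1 + \<eta>) * (dist z' y)\<^sup>2" "2 * \<eta>"] times_divide_eq_left)
        finally show ?thesis using False by simp
      qed
      then have "ennreal ((dist x y)\<^sup>2 + \<alpha> * indicator Bad z)
          \<le> ennreal (1 / t * (dist x z)\<^sup>2 + (c * (dist z' y)\<^sup>2 + e))" by (intro ennreal_leI) simp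
      moreover have "ennreal ((dist x y)\<^sup>2 + \<alpha> * indicator Bad z)
          = ennreal ((dist x y)\<^sup>2) + ennreal \<alpha> * indicator Bad z"
        using \<alpha> by (simp split: split_indicator)
      moreover have "ennreal (1 / t * (dist x z)\<^sup>2 + (c * (dist z' y)\<^sup>2 + e))
          = ennreal (1 / t) * ennreal ((dist x z)\<^sup>2) + (ennreal c * ennreal ((dist z' y)\<^sup>2) + ennreal e)"
        using t ce by (intro ennreal_affine_combination[symmetric]) auto
      ultimately show ?case by (simp add: x_def y_def z_def z'_def)
    qed
    then have "(\<integral>\<^sup>+ w. ennreal ((dist (fst (fst w)) (snd (snd w)))\<^sup>2) + ennreal \<alpha> * indicator Bad (snd (fst w)) \<partial>M)
        \<le> (\<integral>\<^sup>+ w. ennreal (1 / t) * ennreal ((dist (fst (fst w)) (snd (fst w)))\<^sup>2)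
          + (ennreal c * ennreal ((dist (fst (snd w)) (snd (snd w)))\<^sup>2) + ennreal e) \<partial>M)"
      by (rule nn_integral_mono_AE)
    also have "\<dots> = ennreal (1 / t) * transport_cost \<pi>0 + (ennreal c * transport_cost \<pi>1 + ennreal e)"
      unfolding cost0[symmetric] cost1[symmetric]
      by (simp add: nn_integral_add nn_integral_cmult M.emeasure_space_1)
    also have "(\<integral>\<^sup>+ w. ennreal ((dist (fst (fst w)) (snd (snd w)))\<^sup>2) + ennreal \<alpha> * indicator Bad (snd (fst w)) \<partial>M)
        = (\<integral>\<^sup>+ w. ennreal ((dist (fst (fst w)) (snd (snd w)))\<^sup>2) \<partial>M) + ennreal \<alpha> * emeasure \<nu>t Bad"
      unfolding bad[symmetric] by (simp add: nn_integral_add nn_integral_cmult)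
    finally have "ennreal (W\<^sup>2) + ennreal \<alpha> * emeasure \<nu>t Bad
        \<le> ennreal (1 / t) * transport_cost \<pi>0 + (ennreal c * transport_cost \<pi>1 + ennreal e)"
      using W_le by (meson add_right_mono order_trans)
    also have "\<dots> \<le> ennreal (1 / t) * ennreal ((t * W)\<^sup>2 + \<eta>)
        + (ennreal c * ennreal (((1 - t) * W)\<^sup>2 + \<eta>) + ennreal e)"
      by (intro add_mono mult_left_mono \<pi>0 \<pi>1) auto
    also have "\<dots> = ennreal (1 / t * ((t * W)\<^sup>2 + \<eta>) + (c * (((1 - t) * W)\<^sup>2 + \<eta>) + e))"
      using t \<eta> ce by (intro ennreal_affine_combination) auto
    also have "ennreal (W\<^sup>2) + ennreal \<alpha> * emeasure \<nu>t Bad = ennreal (W\<^sup>2 + \<alpha> * measure \<nu>t Bad)"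
      using \<alpha> by (simp add: \<nu>t.emeasure_eq_measure ennreal_mult')
    finally have "ennreal (W\<^sup>2 + \<alpha> * measure \<nu>t Bad)
        \<le> ennreal (1 / t * ((t * W)\<^sup>2 + \<eta>) + (c * (((1 - t) * W)\<^sup>2 + \<eta>) + e))" .
    then have "W\<^sup>2 + \<alpha> * measure \<nu>t Bad \<le> 1 / t * ((t * W)\<^sup>2 + \<eta>) + (c * (((1 - t) * W)\<^sup>2 + \<eta>) + e)"
      using t \<eta> ce by (subst (asm) ennreal_le_iff) auto
    also have "1 / t * ((t * W)\<^sup>2 + \<eta>) = t * W\<^sup>2 + \<eta> / t"
      using t by (simp add: field_simps power2_eq_square)
    also have "c * (((1 - t) * W)\<^sup>2 + \<eta>) = (1 + \<eta>) * ((1 - t) * W\<^sup>2) + (1 + \<eta>) * \<eta> / (1 - t)"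
      using t by (simp add: c_def field_simps power2_eq_square)
    also have "(1 + \<eta>) * ((1 - t) * W\<^sup>2) \<le> (1 - t) * W\<^sup>2 + \<eta> * W\<^sup>2"
    proof -
      have "\<eta> * ((1 - t) * W\<^sup>2) \<le> \<eta> * W\<^sup>2" using t \<eta> by (intro mult_left_mono mult_left_le_one_le) auto
      then show ?thesis by (simp add: algebra_simps)
    qed
    also have "(1 + \<eta>) * \<eta> / (1 - t) \<le> 2 * \<eta> / (1 - t)"
      using t \<eta> by (intro divide_right_mono mult_right_mono) auto
    finally have "W\<^sup>2 + \<alpha> * measure \<nu>t Bad
        \<le> t * W\<^sup>2 + \<eta> / t + ((1 - t) * W\<^sup>2 + \<eta> * W\<^sup>2 + 2 * \<eta> / (1 - t) + e)" by simp
    also have "\<dots> = W\<^sup>2 + \<eta> * K"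
    proof -
      have "2 * \<eta> / (1 - t) + e = \<eta> * (4 / (1 - t))"
        by (simp add: e_def flip: add_divide_distrib)
      moreover have "\<eta> * K = \<eta> / t + \<eta> * W\<^sup>2 + \<eta> * (4 / (1 - t))" by (simp add: K_def distrib_left)
      moreover have "t * W\<^sup>2 + (1 - t) * W\<^sup>2 = W\<^sup>2" by (simp add: left_diff_distrib)
      ultimately show ?thesis by linarith
    qed
    finally show ?thesis by simp
  qed
  have K: "K \<ge> 1" using t by (auto simp: K_def intro!: add_increasing2)
  have "measure \<nu>t Bad \<le> 0"
  proof (rule ccontr)
    assume "\<not> measure \<nu>t Bad \<le> 0"
    then have pos: "0 < \<alpha> * measure \<nu>t Bad" using \<alpha> by simp
    define \<eta> where "\<eta> = min (1 / 2) (\<alpha> * measure \<nu>t Bad / (2 * K))"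
    have "0 < \<eta>" "\<eta> < 1" using pos K by (auto simp: \<eta>_def)
    from key[OF this] have "\<alpha> * measure \<nu>t Bad \<le> \<eta> * K" .
    also have "\<dots> \<le> \<alpha> * measure \<nu>t Bad / (2 * K) * K"
      using K by (intro mult_right_mono) (auto simp: \<eta>_def)
    also have "\<dots> = \<alpha> * measure \<nu>t Bad / 2" using K by simp
    finally show False using pos by simp
  qed
  then have "Bad \<in> null_sets \<nu>t"
    using Bad measure_nonneg[of \<nu>t Bad] by (auto simp: null_sets_def setst \<nu>t.emeasure_eq_measure)
  then show ?thesis by (rule AE_I') (auto simp: Bad_def not_le)
qed

section \<open>Entropy of concentrated measures\<close>

lemma mms_sigma_finite:
  assumes "metric_measure_space m"
  shows "sigma_finite_measure m"
proof -
  from assms have sets_m: "sets m = sets borel"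
    and "\<forall>x. \<exists>r>0. emeasure m (ball x r) < \<infinity>" by (auto simp: metric_measure_space_def)
  then obtain r where r: "\<And>x. r x > 0" "\<And>x. emeasure m (ball x (r x)) < \<infinity>" by metis
  obtain F where F: "F \<subseteq> range (\<lambda>x. ball x (r x))" "countable F" "\<Union>F = (\<Union>x. ball x (r x))"
    using Lindelof[of "range (\<lambda>x. ball x (r x))"] by auto
  have "(\<Union>x. ball x (r x)) = UNIV" using r(1) by auto
  then have "\<Union>F = space m" using F(3) sets_eq_imp_space_eq[OF sets_m] by simp
  then show ?thesis using F(1,2) r(2)
    by (intro sigma_finite_measure.intro exI[of _ F]) (auto simp: sets_m less_top)
qed

text \<open>Jensen's inequality for the power \<open>1 - 1/N\<close>, in the form of the weighted arithmetic-geometric inequality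
\<open>\<rho>\<^bsup>1-1/N\<^esup> (1/V)\<^bsup>1/N\<^esup> \<le> (1 - 1/N) \<rho> + (1/N) (1/V)\<close> with \<open>V = m(U)\<close>, integrated over \<open>U\<close>.\<close>
lemma S_ent_ge:
  fixes m :: "'a::polish_space measure"
  assumes mms: "metric_measure_space m" and \<nu>: "\<nu> \<in> P2_ac m" and N: "N > 1"
    and U: "U \<in> sets borel" "emeasure m U < \<infinity>" and conc: "AE x in \<nu>. x \<in> U"
  shows "- ereal (measure m U powr (1 / N)) \<le> S_ent m N \<nu>"
proof -
  interpret m: sigma_finite_measure m by (rule mms_sigma_finite[OF mms])
  have sets_m[measurable_cong]: "sets m = sets borel" using mms by (simp add: metric_measure_space_def)
  have sets_\<nu>: "sets \<nu> = sets m" and ac: "absolutely_continuous m \<nu>" and "prob_space \<nu>"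
    using \<nu> sets_m by (auto simp: P2_ac_def P2_def)
  interpret \<nu>: prob_space \<nu> by fact
  have space_m[simp]: "space m = UNIV" "space \<nu> = UNIV"
    using sets_eq_imp_space_eq[OF sets_m] sets_eq_imp_space_eq[OF sets_\<nu>] by auto
  have [measurable]: "U \<in> sets m" "U \<in> sets \<nu>" using U sets_m sets_\<nu> by auto
  obtain D where D: "D \<in> borel_measurable m" "AE x in m. RN_deriv m \<nu> x = ennreal (D x)" "\<And>x. 0 \<le> D x"
    using m.real_RN_deriv[OF \<nu>.finite_measure_axioms ac sets_\<nu>] by metis
  have "density m (\<lambda>x. ennreal (D x)) = \<nu>"
    using m.density_RN_deriv[OF ac sets_\<nu>] density_cong[OF _ _ D(2)] D(1) by simp
  then have "lebesgue_decomposition m \<nu> D (null_measure m)"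
    using D by (auto simp: lebesgue_decomposition_def intro!: bexI[of _ "{}"])
  \<comment> \<open>The entropy is defined with a chosen Lebesgue decomposition. One exists by Radon-Nikodym, so the chosen one satisfies \<open>\<rho> m \<le> \<nu>\<close>.\<close>
  define \<rho> where "\<rho> = (SOME \<rho>. \<exists>\<nu>s. lebesgue_decomposition m \<nu> \<rho> \<nu>s)"
  have "\<exists>\<rho> \<nu>s. lebesgue_decomposition m \<nu> \<rho> \<nu>s"
    using \<open>lebesgue_decomposition m \<nu> D (null_measure m)\<close> by blast
  from someI_ex[OF this] have "\<exists>\<nu>s. lebesgue_decomposition m \<nu> \<rho> \<nu>s"
    unfolding \<rho>_def .
  then have \<rho>[measurable]: "\<rho> \<in> borel_measurable m" and \<rho>0: "\<And>x. 0 \<le> \<rho> x"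
    and le: "\<And>A. A \<in> sets m \<Longrightarrow> emeasure (density m (\<lambda>x. ennreal (\<rho> x))) A \<le> emeasure \<nu> A"
    by (auto simp: lebesgue_decomposition_def)
  have cU: "- U \<in> sets borel" using U(1) by (rule borel_comp)
  have "emeasure (density m (\<lambda>x. ennreal (\<rho> x))) (- U) = 0"
  proof -
    have "emeasure \<nu> (- U) = 0"
      using conc by (subst (asm) AE_iff_measurable[of "- U"]) (auto simp: sets_\<nu> sets_m cU)
    then show ?thesis using le[of "- U"] cU sets_m by simp
  qed
  then have "- U \<in> null_sets (density m (\<lambda>x. ennreal (\<rho> x)))" using cU sets_m by (intro null_setsI) auto
  then have out: "AE x in m. x \<in> - U \<longrightarrow> \<rho> x = 0"
    using \<rho>0 by (subst (asm) null_sets_density_iff) (auto elim: AE_mp intro: antisym)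
  have mass: "(\<integral>\<^sup>+ x. ennreal (\<rho> x) \<partial>m) \<le> 1"
    using le[of UNIV] \<nu>.emeasure_space_1 by (simp add: emeasure_density)
  define V where "V = measure m U"
  have mU: "emeasure m U = ennreal V" using U(2) by (simp add: V_def emeasure_eq_ennreal_measure less_top)
  have "(\<integral>\<^sup>+ x. ennreal (\<rho> x powr (1 - 1 / N)) \<partial>m) \<le> ennreal (V powr (1 / N))"
  proof (cases "V = 0")
    case True
    then have "U \<in> null_sets m" using mU by (intro null_setsI) auto
    then have "AE x in m. x \<notin> U" by (rule AE_not_in)
    with out have "AE x in m. ennreal (\<rho> x powr (1 - 1 / N)) = 0" by eventually_elim auto
    then have "(\<integral>\<^sup>+ x. ennreal (\<rho> x powr (1 - 1 / N)) \<partial>m) = (\<integral>\<^sup>+ x. 0 \<partial>m)"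
      by (rule nn_integral_cong_AE)
    then show ?thesis by simp
  next
    case False
    then have V: "V > 0" using measure_nonneg[of m U] unfolding V_def by linarith
    define A where "A = V powr (1 / N) * (1 - 1 / N)"
    define B where "B = V powr (1 / N) * (1 / N) / V"
    have AB: "A \<ge> 0" "B \<ge> 0" using N V by (auto simp: A_def B_def)
    have "AE x in m. ennreal (\<rho> x powr (1 - 1 / N)) \<le> ennreal A * ennreal (\<rho> x) + ennreal B * indicator U x"
      using out
    proof eventually_elim
      case (elim x)
      show ?case
      proof (cases "\<rho> x = 0")
        case False
        then have xU: "x \<in> U" and pos: "\<rho> x > 0" using elim \<rho>0[of x] by (auto intro: le_neq_trans)
        have "\<rho> x powr (1 - 1 / N) * (1 / V) powr (1 / N) \<le> (1 - 1 / N) * \<rho> x + (1 / N) * (1 / V)"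
          using N V pos by (intro Youngs_inequality_0) auto
        then have "V powr (1 / N) * (\<rho> x powr (1 - 1 / N) * (1 / V) powr (1 / N))
            \<le> V powr (1 / N) * ((1 - 1 / N) * \<rho> x + (1 / N) * (1 / V))" by (intro mult_left_mono) auto
        moreover have "V powr (1 / N) * (1 / V) powr (1 / N) = 1"
          using V by (simp flip: powr_mult)
        then have "V powr (1 / N) * (\<rho> x powr (1 - 1 / N) * (1 / V) powr (1 / N)) = \<rho> x powr (1 - 1 / N)"
          by (metis mult.left_commute mult.right_neutral)
        ultimately have "\<rho> x powr (1 - 1 / N) \<le> A * \<rho> x + B"
          by (simp add: A_def B_def distrib_left mult.assoc)
        then have "ennreal (\<rho> x powr (1 - 1 / N)) \<le> ennreal (A * \<rho> x + B)" by (rule ennreal_leI)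
        then show ?thesis using AB \<rho>0 xU by (simp add: ennreal_mult)
      qed simp
    qed
    then have "(\<integral>\<^sup>+ x. ennreal (\<rho> x powr (1 - 1 / N)) \<partial>m)
        \<le> (\<integral>\<^sup>+ x. ennreal A * ennreal (\<rho> x) + ennreal B * indicator U x \<partial>m)"
      by (rule nn_integral_mono_AE)
    also have "\<dots> = ennreal A * (\<integral>\<^sup>+ x. ennreal (\<rho> x) \<partial>m) + ennreal B * ennreal V"
      by (simp add: nn_integral_add nn_integral_cmult mU nn_integral_cmult_indicator)
    also have "\<dots> \<le> ennreal A * 1 + ennreal B * ennreal V"
      by (intro add_mono mult_left_mono mass) auto
    also have "\<dots> = ennreal (A + B * V)" using AB V by (simp add: ennreal_mult)
    also have "A + B * V = V powr (1 / N)" using V by (simp add: A_def B_def algebra_simps)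
    finally show ?thesis .
  qed
  then have "enn2ereal (\<integral>\<^sup>+ x. ennreal (\<rho> x powr (1 - 1 / N)) \<partial>m) \<le> ereal (V powr (1 / N))"
    by (metis enn2ereal_ennreal less_eq_ennreal.rep_eq powr_ge_zero)
  then show ?thesis
    unfolding S_ent_def Let_def \<rho>_def[symmetric] V_def[symmetric] by (simp only: ereal_minus_le_minus)
qed

section \<open>The curvature-dimension condition between balls\<close>

definition ball_density :: "'a::metric_space measure \<Rightarrow> 'a \<Rightarrow> real \<Rightarrow> 'a \<Rightarrow> real" where
  "ball_density m x r z = indicator (ball x r) z / measure m (ball x r)"

definition uniform_ball :: "'a::metric_space measure \<Rightarrow> 'a \<Rightarrow> real \<Rightarrow> 'a measure" where
  "uniform_ball m x r = density m (\<lambda>z. ennreal (ball_density m x r z))"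

lemma finite_measure_small_ball:
  assumes "metric_measure_space m" "e > 0"
  shows "\<exists>r>0. r \<le> e \<and> emeasure m (ball z r) < \<infinity>"
proof -
  obtain r where r: "r > 0" "emeasure m (ball z r) < \<infinity>"
    using assms(1) by (auto simp: metric_measure_space_def)
  have "emeasure m (ball z (min r e)) \<le> emeasure m (ball z r)"
    using assms(1) by (intro emeasure_mono) (auto simp: metric_measure_space_def)
  then show ?thesis using r assms(2) by (intro exI[of _ "min r e"]) (auto intro: le_less_trans)
qed

lemma measure_ball_pos:
  fixes m :: "'a::polish_space measure"
  assumes "msupp m = UNIV" "r > 0" "emeasure m (ball x r) < \<infinity>"
  shows "measure m (ball x r) > 0"
proof -
  have "0 < emeasure m (ball x r)"
  proof -
    have "x \<in> msupp m" using assms(1) by simp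
    then show ?thesis using assms(2) by (auto simp: msupp_def)
  qed
  then show ?thesis using assms(3) by (simp add: measure_def enn2real_positive_iff)
qed

lemma uniform_ball_facts:
  fixes m :: "'a::polish_space measure"
  assumes mms: "metric_measure_space m" and supp: "msupp m = UNIV"
    and r: "r > 0" and fin: "emeasure m (ball x r) < \<infinity>"
  shows "ball_density m x r \<in> borel_measurable m" "\<And>z. 0 \<le> ball_density m x r z"
    "AE z in uniform_ball m x r. z \<in> ball x r"
    "uniform_ball m x r \<in> P2_ac m" "bounded (msupp (uniform_ball m x r))"
proof -
  have sets_m[measurable_cong]: "sets m = sets borel" using mms by (simp add: metric_measure_space_def)
  have space_m: "space m = UNIV" using sets_eq_imp_space_eq[OF sets_m] by simp
  define V where "V = measure m (ball x r)"
  have V: "V > 0" unfolding V_def by (rule measure_ball_pos[OF supp r fin])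
  have mB: "emeasure m (ball x r) = ennreal V"
    using fin by (simp add: V_def emeasure_eq_ennreal_measure less_top)
  show meas[measurable]: "ball_density m x r \<in> borel_measurable m"
    unfolding ball_density_def[abs_def] using sets_m by (intro borel_measurable_divide borel_measurable_indicator) auto
  show nonneg: "0 \<le> ball_density m x r z" for z
    by (simp add: ball_density_def)
  let ?\<nu> = "uniform_ball m x r"
  have sets_\<nu>[simp]: "sets ?\<nu> = sets borel" by (simp add: uniform_ball_def sets_m)
  show conc: "AE z in ?\<nu>. z \<in> ball x r"
    unfolding uniform_ball_def by (subst AE_density) (auto simp: ball_density_def indicator_def)
  have B[measurable]: "ball x r \<in> sets m" by (simp add: sets_m)
  have meas: "(\<lambda>z. ennreal (1 / V) * indicator (ball x r) z) \<in> borel_measurable m" by measurable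
  have "(\<lambda>z. ennreal (ball_density m x r z)) = (\<lambda>z. ennreal (1 / V) * indicator (ball x r) z)"
    by (auto simp: ball_density_def V_def fun_eq_iff split: split_indicator)
  then have "emeasure ?\<nu> UNIV = ennreal (1 / V) * ennreal V"
    unfolding uniform_ball_def
    by (subst emeasure_density) (use meas in \<open>auto simp: sets_m nn_integral_cmult_indicator mB\<close>)
  then have "emeasure ?\<nu> (space ?\<nu>) = 1"
    using V by (simp add: uniform_ball_def space_m flip: ennreal_mult)
  then have prob: "prob_space ?\<nu>" by (rule prob_spaceI)
  have "(\<integral>\<^sup>+ z. ennreal ((dist x z)\<^sup>2) \<partial>?\<nu>) \<le> (\<integral>\<^sup>+ z. ennreal (r\<^sup>2) \<partial>?\<nu>)"
    using conc by (intro nn_integral_mono_AE) (auto elim!: eventually_mono intro!: ennreal_leI power_mono)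
  also have "\<dots> < \<infinity>" using prob by (simp add: prob_space.emeasure_space_1)
  finally have "?\<nu> \<in> P2" using prob by (auto simp: P2_def)
  then show "?\<nu> \<in> P2_ac m"
    unfolding P2_ac_def uniform_ball_def by (auto intro!: absolutely_continuousI_density)
  have "msupp ?\<nu> \<subseteq> cball x r"
  proof
    fix z assume z: "z \<in> msupp ?\<nu>"
    show "z \<in> cball x r"
    proof (rule ccontr)
      assume "z \<notin> cball x r"
      then have "0 < emeasure ?\<nu> (- cball x r)" using z by (auto simp: msupp_def)
      moreover have "- cball x r \<in> null_sets ?\<nu>"
        using conc by (subst AE_iff_null_sets) (auto elim: eventually_mono)
      ultimately show False by auto
    qed
  qed
  then show "bounded (msupp ?\<nu>)" by (rule bounded_subset[OF bounded_cball])
qed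

lemma continuous_on_eval_bcontfun: "continuous_on S (\<lambda>\<gamma> :: real \<Rightarrow>\<^sub>C 'a::metric_space. apply_bcontfun \<gamma> s)"
proof -
  have "1-lipschitz_on S (\<lambda>\<gamma> :: real \<Rightarrow>\<^sub>C 'a. apply_bcontfun \<gamma> s)"
    by (rule lipschitz_onI) (auto intro: dist_bounded)
  then show ?thesis by (rule lipschitz_on_continuous_on)
qed

lemma AE_dynamical_coupling:
  fixes \<mu> \<nu> :: "'a::polish_space measure"
  assumes \<Xi>: "dynamical_optimal_coupling \<mu> \<nu> \<Xi>" and P: "AE x in \<mu>. P x" and Q: "AE y in \<nu>. Q y"
  shows "AE \<gamma> in \<Xi>. \<gamma> \<in> geodesics \<and> P (apply_bcontfun \<gamma> 0) \<and> Q (apply_bcontfun \<gamma> 1)"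
proof -
  let ?e = "\<lambda>\<gamma> :: real \<Rightarrow>\<^sub>C 'a. (apply_bcontfun \<gamma> 0, apply_bcontfun \<gamma> 1)"
  have sets: "sets \<Xi> = sets (restrict_space borel geodesics)"
    and c: "distr \<Xi> borel ?e \<in> couplings \<mu> \<nu>"
    using \<Xi> by (auto simp: dynamical_optimal_coupling_def optimal_coupling_def)
  have "?e \<in> measurable borel (borel :: ('a \<times> 'a) measure)"
    by (intro borel_measurable_continuous_onI continuous_on_Pair continuous_on_eval_bcontfun)
  then have "?e \<in> measurable \<Xi> borel"
    using sets by (simp add: measurable_restrict_space1 cong: measurable_cong_sets)
  from AE_distrD[OF this AE_couplingD[OF c P Q]]
  have "AE \<gamma> in \<Xi>. P (apply_bcontfun \<gamma> 0) \<and> Q (apply_bcontfun \<gamma> 1)" by simp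
  moreover have "AE \<gamma> in \<Xi>. \<gamma> \<in> geodesics"
    using sets_eq_imp_space_eq[OF sets] by (intro AE_I2) (auto simp: space_restrict_space)
  ultimately show ?thesis by eventually_elim auto
qed

lemma CD_between_balls:
  fixes m :: "'a::polish_space measure" and x y :: 'a
  assumes mms: "metric_measure_space m" and supp: "msupp m = UNIV" and CD: "CD m k N"
    and \<delta>: "\<delta> > 0" "emeasure m (ball x \<delta>) < \<infinity>" and \<eta>: "\<eta> > 0" "emeasure m (ball y \<eta>) < \<infinity>"
  obtains \<Xi> \<nu> where
    "dynamical_optimal_coupling (uniform_ball m x \<delta>) (uniform_ball m y \<eta>) \<Xi>"
    "AE \<gamma> in \<Xi>. \<gamma> \<in> geodesics \<and> apply_bcontfun \<gamma> 0 \<in> ball x \<delta> \<and> apply_bcontfun \<gamma> 1 \<in> ball y \<eta>"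
    "\<And>t. t \<in> {0..1} \<Longrightarrow> \<nu> t \<in> P2_ac m" "geodesic_wrt W2 \<nu>"
    "\<nu> 0 = uniform_ball m x \<delta>" "\<nu> 1 = uniform_ball m y \<eta>"
    "\<And>t. t \<in> {0..1} \<Longrightarrow> S_ent m N (\<nu> t) \<le>
        - enn2ereal (\<integral>\<^sup>+ \<gamma>.
            (tau_coeff (k_minus k \<gamma>) N (1 - t) (speed \<gamma>)
               * inverse (ennreal (ball_density m x \<delta> (apply_bcontfun \<gamma> 0) powr (1 / N)))
             + tau_coeff (k_plus k \<gamma>) N t (speed \<gamma>)
               * inverse (ennreal (ball_density m y \<eta> (apply_bcontfun \<gamma> 1) powr (1 / N)))) \<partial>\<Xi>)"
proof -
  note ux = uniform_ball_facts[OF mms supp \<delta>] and uy = uniform_ball_facts[OF mms supp \<eta>]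
  obtain \<Xi> \<nu> where *: "dynamical_optimal_coupling (uniform_ball m x \<delta>) (uniform_ball m y \<eta>) \<Xi>"
    "\<forall>t\<in>{0..1}. \<nu> t \<in> P2_ac m" "geodesic_wrt W2 \<nu>"
    "\<nu> 0 = uniform_ball m x \<delta>" "\<nu> 1 = uniform_ball m y \<eta>"
    "\<forall>t\<in>{0..1}. \<forall>N'\<ge>N. S_ent m N' (\<nu> t) \<le>
        - enn2ereal (\<integral>\<^sup>+ \<gamma>.
            (tau_coeff (k_minus k \<gamma>) N' (1 - t) (speed \<gamma>)
               * inverse (ennreal (ball_density m x \<delta> (apply_bcontfun \<gamma> 0) powr (1 / N')))
             + tau_coeff (k_plus k \<gamma>) N' t (speed \<gamma>)
               * inverse (ennreal (ball_density m y \<eta> (apply_bcontfun \<gamma> 1) powr (1 / N')))) \<partial>\<Xi>)"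
    using CD[unfolded CD_def, rule_format, OF ux(4) uy(4) ux(1) uy(1) ux(2) uy(2)
        uniform_ball_def uniform_ball_def ux(5) uy(5)] by blast
  show thesis
    by (rule that[OF *(1) AE_dynamical_coupling[OF *(1) ux(3) uy(3)] _ *(3-5)])
       (use *(2,6) in auto)
qed

text \<open>Almost every geodesic of a dynamical coupling between two small balls has this property, and a
probability measure is not zero.\<close>
lemma CD_geodesic_near:
  fixes m :: "'a::polish_space measure" and x y :: 'a
  assumes mms: "metric_measure_space m" and supp: "msupp m = UNIV" and CD: "CD m k N" and e: "e > 0"
  obtains \<gamma> where "\<gamma> \<in> geodesics" "dist x (apply_bcontfun \<gamma> 0) < e" "dist y (apply_bcontfun \<gamma> 1) < e"
proof -
  obtain \<delta> \<eta> where d: "\<delta> > 0" "\<delta> \<le> e" "emeasure m (ball x \<delta>) < \<infinity>"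
    "\<eta> > 0" "\<eta> \<le> e" "emeasure m (ball y \<eta>) < \<infinity>"
    using finite_measure_small_ball[OF mms e] by meson
  obtain \<Xi> where \<Xi>: "dynamical_optimal_coupling (uniform_ball m x \<delta>) (uniform_ball m y \<eta>) \<Xi>"
    and ae: "AE \<gamma> in \<Xi>. \<gamma> \<in> geodesics \<and> apply_bcontfun \<gamma> 0 \<in> ball x \<delta> \<and> apply_bcontfun \<gamma> 1 \<in> ball y \<eta>"
    by (rule CD_between_balls[OF mms supp CD d(1,3,4,6)]) (rule that)
  interpret prob_space \<Xi> using \<Xi> by (simp add: dynamical_optimal_coupling_def)
  have "ae_filter \<Xi> \<noteq> bot" by (simp add: ae_filter_eq_bot_iff emeasure_space_1)
  from eventually_happens'[OF this ae] obtain \<gamma> where "\<gamma> \<in> geodesics" "apply_bcontfun \<gamma> 0 \<in> ball x \<delta>" "apply_bcontfun \<gamma> 1 \<in> ball y \<eta>"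
    by blast
  then show thesis using d by (intro that[of \<gamma>]) auto
qed

text \<open>The density of the target measure is \<open>1/m(B(y,\<eta>))\<close>, so the term of the target alone makes the right hand
side of the curvature-dimension inequality at most \<open>- C m(B(y,\<eta>))\<^bsup>1/N\<^esup>\<close>. The condition on \<open>t\<close> keeps the
intermediate measure on \<open>B(x,r)\<close>, whose finite mass bounds the entropy from the other side.\<close>
lemma CD_ball_estimate:
  fixes m :: "'a::polish_space measure" and x y :: 'a
  assumes mms: "metric_measure_space m" and supp: "msupp m = UNIV" and CD: "CD m k N" and N: "N > 1"
    and \<delta>: "0 < \<delta>" "\<delta> < r" and fin_r: "emeasure m (ball x r) < \<infinity>"
    and \<eta>: "\<eta> > 0" "emeasure m (ball y \<eta>) < \<infinity>"
    and t: "0 < t" "t < 1" and L: "dist x y + \<delta> + \<eta> \<le> L" and tL: "t * (L\<^sup>2 + 1) \<le> (r - \<delta>)\<^sup>2"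
    and C: "\<And>\<gamma>. \<gamma> \<in> geodesics \<Longrightarrow> apply_bcontfun \<gamma> 0 \<in> ball x \<delta> \<Longrightarrow> apply_bcontfun \<gamma> 1 \<in> ball y \<eta> \<Longrightarrow>
        C \<le> tau_coeff (k_plus k \<gamma>) N t (speed \<gamma>)"
  shows "C * ennreal (measure m (ball y \<eta>) powr (1 / N)) \<le> ennreal (measure m (ball x r) powr (1 / N))"
proof -
  have sets_m: "sets m = sets borel" using mms by (simp add: metric_measure_space_def)
  have "emeasure m (ball x \<delta>) \<le> emeasure m (ball x r)"
    using \<delta> sets_m by (intro emeasure_mono) auto
  then have fin_\<delta>: "emeasure m (ball x \<delta>) < \<infinity>" using fin_r by (rule le_less_trans)
  note ux = uniform_ball_facts[OF mms supp \<delta>(1) fin_\<delta>] and uy = uniform_ball_facts[OF mms supp \<eta>]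
  obtain \<Xi> \<nu> where \<Xi>: "dynamical_optimal_coupling (uniform_ball m x \<delta>) (uniform_ball m y \<eta>) \<Xi>"
    and ae: "AE \<gamma> in \<Xi>. \<gamma> \<in> geodesics \<and> apply_bcontfun \<gamma> 0 \<in> ball x \<delta> \<and> apply_bcontfun \<gamma> 1 \<in> ball y \<eta>"
    and \<nu>: "\<And>t. t \<in> {0..1} \<Longrightarrow> \<nu> t \<in> P2_ac m" "geodesic_wrt W2 \<nu>"
      "\<nu> 0 = uniform_ball m x \<delta>" "\<nu> 1 = uniform_ball m y \<eta>"
    and S: "\<And>t. t \<in> {0..1} \<Longrightarrow> S_ent m N (\<nu> t) \<le>
        - enn2ereal (\<integral>\<^sup>+ \<gamma>.
            (tau_coeff (k_minus k \<gamma>) N (1 - t) (speed \<gamma>)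
               * inverse (ennreal (ball_density m x \<delta> (apply_bcontfun \<gamma> 0) powr (1 / N)))
             + tau_coeff (k_plus k \<gamma>) N t (speed \<gamma>)
               * inverse (ennreal (ball_density m y \<eta> (apply_bcontfun \<gamma> 1) powr (1 / N)))) \<partial>\<Xi>)"
    by (rule CD_between_balls[OF mms supp CD \<delta>(1) fin_\<delta> \<eta>]) (rule that)
  interpret \<Xi>: prob_space \<Xi> using \<Xi> by (simp add: dynamical_optimal_coupling_def)
  have t01: "t \<in> {0..1}" using t by simp
  have P2: "\<nu> s \<in> P2" if "s \<in> {0..1}" for s using \<nu>(1)[OF that] by (simp add: P2_ac_def)
  have "AE z in \<nu> t. \<exists>w\<in>ball x \<delta>. (dist w z)\<^sup>2 < t * (L\<^sup>2 + 1)"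
  proof (rule W2_geodesic_concentration[of "\<nu> 0" _ "\<nu> 1"])
    have "W2 (\<nu> s) (\<nu> s') = \<bar>s - s'\<bar> * W2 (\<nu> 0) (\<nu> 1)" if "s \<in> {0..1}" "s' \<in> {0..1}" for s s'
      using \<nu>(2) that unfolding geodesic_wrt_def by blast
    from this[of 0 t] this[of t 1] show "W2 (\<nu> 0) (\<nu> t) = t * W2 (\<nu> 0) (\<nu> 1)"
      "W2 (\<nu> t) (\<nu> 1) = (1 - t) * W2 (\<nu> 0) (\<nu> 1)" using t by auto
    show "AE z in \<nu> 0. z \<in> ball x \<delta>" "AE z in \<nu> 1. z \<in> ball y \<eta>" unfolding \<nu>(3,4) by (rule ux(3) uy(3))+
    show "dist w z \<le> L" if "w \<in> ball x \<delta>" "z \<in> ball y \<eta>" for w z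
      using that L dist_triangle[of w z x] dist_triangle[of x z y] by (simp add: dist_commute)
  qed (use t P2 in auto)
  then have conc: "AE z in \<nu> t. z \<in> ball x r"
  proof eventually_elim
    case (elim z)
    then obtain w where w: "w \<in> ball x \<delta>" "(dist w z)\<^sup>2 < t * (L\<^sup>2 + 1)" by blast
    have "dist w z < r - \<delta>"
      by (rule power_less_imp_less_base[of _ 2]) (use \<delta> less_le_trans[OF w(2) tL] in auto)
    then show ?case using w(1) dist_triangle[of x z w] by simp
  qed
  define V where "V = measure m (ball y \<eta>)"
  have V: "V > 0" unfolding V_def by (rule measure_ball_pos[OF supp \<eta>])
  define I where "I = (\<integral>\<^sup>+ \<gamma>.
            (tau_coeff (k_minus k \<gamma>) N (1 - t) (speed \<gamma>)
               * inverse (ennreal (ball_density m x \<delta> (apply_bcontfun \<gamma> 0) powr (1 / N)))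
             + tau_coeff (k_plus k \<gamma>) N t (speed \<gamma>)
               * inverse (ennreal (ball_density m y \<eta> (apply_bcontfun \<gamma> 1) powr (1 / N)))) \<partial>\<Xi>)"
  have "C * ennreal (V powr (1 / N)) = (\<integral>\<^sup>+ \<gamma>. C * ennreal (V powr (1 / N)) \<partial>\<Xi>)"
    by (simp add: \<Xi>.emeasure_space_1)
  also have "\<dots> \<le> I"
    unfolding I_def
  proof (rule nn_integral_mono_AE, use ae in eventually_elim)
    case (elim \<gamma>)
    have "inverse (ennreal ((1 / V) powr (1 / N))) = ennreal (V powr (1 / N))"
      using V by (subst inverse_ennreal) (simp_all add: powr_divide)
    then have "C * ennreal (V powr (1 / N)) \<le> tau_coeff (k_plus k \<gamma>) N t (speed \<gamma>)
               * inverse (ennreal (ball_density m y \<eta> (apply_bcontfun \<gamma> 1) powr (1 / N)))"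
      using elim C[of \<gamma>] by (intro mult_mono) (auto simp: ball_density_def V_def)
    then show ?case by (rule add_increasing[OF zero_le])
  qed
  also have "I \<le> ennreal (measure m (ball x r) powr (1 / N))"
  proof -
    have "- ereal (measure m (ball x r) powr (1 / N)) \<le> S_ent m N (\<nu> t)"
      by (rule S_ent_ge[OF mms \<nu>(1)[OF t01] N _ fin_r conc]) simp
    also have "\<dots> \<le> - enn2ereal I" unfolding I_def by (rule S[OF t01])
    finally have "enn2ereal I \<le> ereal (measure m (ball x r) powr (1 / N))"
      by (simp only: ereal_minus_le_minus)
    then show ?thesis by (simp add: less_eq_ennreal.rep_eq enn2ereal_ennreal)
  qed
  finally show ?thesis by (simp add: V_def)
qed

lemma dist_triangle4: "dist a d \<le> dist a b + dist b c + dist c (d :: 'a::metric_space)"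
  using dist_triangle[of a d b] dist_triangle[of b d c] by linarith

lemma geodesic_dist:
  assumes "\<gamma> \<in> geodesics" "s \<in> {0..1}" "t \<in> {0..1}"
  shows "dist (apply_bcontfun \<gamma> s) (apply_bcontfun \<gamma> t) = \<bar>s - t\<bar> * speed \<gamma>"
proof -
  have "geodesic_wrt dist (apply_bcontfun \<gamma>)" using assms(1) by (simp add: geodesics_def)
  then show ?thesis using assms(2,3) unfolding geodesic_wrt_def speed_def by blast
qed

lemma speed_near:
  assumes "dist x (apply_bcontfun \<gamma> 0) < \<delta>" "dist y (apply_bcontfun \<gamma> 1) < \<eta>"
  shows "speed \<gamma> < dist x y + \<delta> + \<eta>" "dist x y - \<delta> - \<eta> < speed \<gamma>"
proof -
  let ?a = "apply_bcontfun \<gamma> 0" and ?b = "apply_bcontfun \<gamma> 1"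
  have "dist ?a ?b \<le> dist x ?a + dist x y + dist y ?b"
    using dist_triangle4[of ?a ?b x y] by (simp add: dist_commute)
  moreover have "dist x y \<le> dist x ?a + dist ?a ?b + dist y ?b"
    using dist_triangle4[of x y ?a ?b] by (simp add: dist_commute)
  ultimately show "speed \<gamma> < dist x y + \<delta> + \<eta>" "dist x y - \<delta> - \<eta> < speed \<gamma>"
    using assms by (simp_all add: speed_def)
qed

text \<open>\<open>X\<close> is a length space: the point is found on a geodesic whose ends are close to \<open>x\<close> and \<open>y\<close>. It is placed
slightly before the parameter \<open>s\<close>, so that its distance from \<open>x\<close> is at most \<open>s\<close> without an error term.\<close>
lemma CD_intermediate_point:
  fixes m :: "'a::polish_space measure" and x y :: 'a
  assumes CD: "metric_measure_space m" "msupp m = UNIV" "CD m k N"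
    and s: "0 \<le> s" "s \<le> dist x y" and e: "e > 0"
  shows "\<exists>z. dist x z \<le> s \<and> dist z y \<le> dist x y - s + e"
proof (cases "s \<le> e")
  case True
  then show ?thesis using s by (intro exI[of _ x]) auto
next
  case False
  \<comment> \<open>The point has distance \<open>s - 2\<delta>\<close> from the start of the geodesic; altogether the errors add up to \<open>5\<delta>\<close>.\<close>
  define \<delta> where "\<delta> = e / 5"
  have \<delta>: "\<delta> > 0" "e = 5 * \<delta>" using e by (auto simp: \<delta>_def)
  obtain \<gamma> where \<gamma>: "\<gamma> \<in> geodesics" "dist x (apply_bcontfun \<gamma> 0) < \<delta>" "dist y (apply_bcontfun \<gamma> 1) < \<delta>"
    using CD_geodesic_near[OF CD \<delta>(1)] by blast
  note sp = speed_near[OF \<gamma>(2,3)]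
  have pos: "0 < s - 2 * \<delta>" "s - 2 * \<delta> \<le> speed \<gamma>" using False \<delta> s sp by auto
  define u where "u = (s - 2 * \<delta>) / speed \<gamma>"
  have u: "u \<in> {0..1}" "u * speed \<gamma> = s - 2 * \<delta>" using pos by (auto simp: u_def)
  define z where "z = apply_bcontfun \<gamma> u"
  have "dist (apply_bcontfun \<gamma> 0) z = s - 2 * \<delta>" "dist z (apply_bcontfun \<gamma> 1) = speed \<gamma> - (s - 2 * \<delta>)"
    using geodesic_dist[OF \<gamma>(1), of 0 u] geodesic_dist[OF \<gamma>(1), of u 1] u
    by (auto simp: z_def algebra_simps)
  moreover have "dist x z \<le> dist x (apply_bcontfun \<gamma> 0) + dist (apply_bcontfun \<gamma> 0) z"
    "dist z y \<le> dist z (apply_bcontfun \<gamma> 1) + dist y (apply_bcontfun \<gamma> 1)"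
    using dist_triangle[of x z "apply_bcontfun \<gamma> 0"] dist_triangle[of z y "apply_bcontfun \<gamma> 1"]
    by (simp_all add: dist_commute)
  ultimately show ?thesis using \<gamma> sp \<delta> by (intro exI[of _ z]) auto
qed

section \<open>Local compactness\<close>

lemma epowr_mono_ennreal:
  assumes "ennreal r \<le> x" "0 \<le> r" "0 \<le> a"
  shows "ennreal (r powr a) \<le> epowr x a"
proof (cases x)
  case (real q)
  then show ?thesis using assms
    by (auto simp: epowr_def intro!: ennreal_leI powr_mono2)
qed (auto simp: epowr_def)

lemma tau_coeff_ge:
  assumes N: "N > 1" and t: "0 < t" "t \<le> 1" and "\<theta> \<ge> 0" "a \<ge> 0"
    and le: "\<And>s. s \<in> {0..\<theta>} \<Longrightarrow> - a\<^sup>2 * (N - 1) \<le> \<kappa> s"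
  shows "ennreal (t * exp (- a * \<theta>)) \<le> tau_coeff \<kappa> N t \<theta>"
proof -
  have "ennreal (t * exp (- a * \<theta>)) \<le> sigma_coeff (\<lambda>s. \<kappa> s / (N - 1)) t \<theta>"
    using le N t assms(4,5) by (intro sigma_coeff_ge) (auto simp: pos_le_divide_eq)
  then have "ennreal (t powr (1 / N)) * ennreal ((t * exp (- a * \<theta>)) powr ((N - 1) / N)) \<le> tau_coeff \<kappa> N t \<theta>"
    unfolding tau_coeff_def using t N by (intro mult_left_mono epowr_mono_ennreal) auto
  moreover have "t * exp (- a * \<theta>) \<le> t powr (1 / N) * (t * exp (- a * \<theta>)) powr ((N - 1) / N)"
  proof -
    have "1 / N + (N - 1) / N = 1" using N by (simp add: field_simps)
    then have "t powr (1 / N) * (t * exp (- a * \<theta>)) powr ((N - 1) / N) = t * exp (- a * \<theta>) powr ((N - 1) / N)"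
      using t by (simp add: powr_mult mult.assoc[symmetric] powr_add[symmetric])
    moreover have "exp (- a * \<theta>) powr 1 \<le> exp (- a * \<theta>) powr ((N - 1) / N)"
      using N assms(4,5) by (intro powr_mono') auto
    ultimately show ?thesis using t by simp
  qed
  ultimately show ?thesis
    by (metis ennreal_leI ennreal_mult' order_trans powr_ge_zero)
qed

text \<open>In a maximal \<open>2s\<close>-separated subset the balls of radius \<open>s\<close> are disjoint, so their number is bounded by
\<open>m(U)/c\<close>; by maximality the balls of radius \<open>2s\<close> cover.\<close>
lemma finite_net_if_ball_measure_ge:
  fixes m :: "'a::metric_space measure"
  assumes sets_m: "sets m = sets borel" and U: "U \<in> sets borel" "emeasure m U < \<infinity>"
    and s: "s > 0" and c: "c > 0"
    and ball: "\<And>y. y \<in> S \<Longrightarrow> ball y s \<subseteq> U" "\<And>y. y \<in> S \<Longrightarrow> ennreal c \<le> emeasure m (ball y s)"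
  shows "\<exists>F. finite F \<and> S \<subseteq> (\<Union>x\<in>F. ball x (2 * s))"
proof -
  define P where "P F \<longleftrightarrow> finite F \<and> F \<subseteq> S \<and> (\<forall>x\<in>F. \<forall>y\<in>F. x \<noteq> y \<longrightarrow> 2 * s \<le> dist x y)" for F
  have card: "card F < Suc (nat \<lceil>measure m U / c\<rceil>)" if "P F" for F
  proof -
    have disj: "disjoint_family_on (\<lambda>y. ball y s) F"
    proof -
      have "ball x s \<inter> ball y s = {}" if "x \<in> F" "y \<in> F" "x \<noteq> y" for x y
      proof -
        have "2 * s \<le> dist x y" using \<open>P F\<close> that by (auto simp: P_def)
        then show ?thesis using dist_triangle_less_add[of x _ s y s] by (auto simp: dist_commute)
      qed
      then show ?thesis by (auto simp: disjoint_family_on_def)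
    qed
    have "ennreal (card F * c) = (\<Sum>y\<in>F. ennreal c)" using c by (simp add: ennreal_mult ennreal_of_nat_eq_real_of_nat)
    also have "\<dots> \<le> (\<Sum>y\<in>F. emeasure m (ball y s))" using that ball by (intro sum_mono) (auto simp: P_def)
    also have "\<dots> = emeasure m (\<Union>y\<in>F. ball y s)"
      using that disj by (intro sum_emeasure) (auto simp: P_def sets_m)
    also have "\<dots> \<le> emeasure m U" using that ball U sets_m by (intro emeasure_mono) (auto simp: P_def)
    also have "\<dots> = ennreal (measure m U)" using U(2) by (simp add: emeasure_eq_ennreal_measure less_top)
    finally have "card F * c \<le> measure m U" by (simp add: ennreal_le_iff)
    then have "real (card F) \<le> measure m U / c" using c by (simp add: field_simps)
    then show ?thesis by linarith
  qed
  obtain F where F: "P F" "\<And>G. P G \<Longrightarrow> card G \<le> card F"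
    using ex_has_greatest_nat[of P "{}" card "Suc (nat \<lceil>measure m U / c\<rceil>)"] card by (auto simp: P_def)
  have "S \<subseteq> (\<Union>x\<in>F. ball x (2 * s))"
  proof
    fix y assume y: "y \<in> S"
    show "y \<in> (\<Union>x\<in>F. ball x (2 * s))"
    proof (rule ccontr)
      assume no: "y \<notin> (\<Union>x\<in>F. ball x (2 * s))"
      then have "y \<notin> F" using s by auto
      moreover have "P (insert y F)" using F(1) y no by (auto simp: P_def not_less dist_commute)
      ultimately show False using F(2)[of "insert y F"] F(1) by (simp add: P_def)
    qed
  qed
  then show ?thesis using F(1) by (auto simp: P_def)
qed

lemma compactI_totally_bounded:
  fixes S :: "'a::complete_space set"
  assumes "closed S" "\<And>e. e > 0 \<Longrightarrow> \<exists>F. finite F \<and> S \<subseteq> (\<Union>x\<in>F. ball x e)"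
  shows "compact S"
  using assms by (auto simp: compact_eq_totally_bounded complete_eq_closed)

text \<open>Let \<open>k \<ge> b\<close> on a ball of finite measure around \<open>x\<close>. Transporting a small ball around \<open>y\<close> to the fixed ball
\<open>B(x,\<rho>)\<close> bounds \<open>m(B(y,s))\<close> from below uniformly in \<open>y\<close>. The radius \<open>\<rho>\<close> is so small that the geodesics,
whose length is less than \<open>4\<rho>\<close>, stay in the region where \<open>k \<ge> b\<close>.\<close>
lemma CD_locally_compact:
  fixes m :: "'a::polish_space measure" and x :: 'a
  assumes mms: "metric_measure_space m" and supp: "msupp m = UNIV" and CD: "CD m k N"
    and N: "N > 1" and k: "locally_bounded_below k"
  shows "\<exists>r>0. compact (cball x r)"
proof -
  have sets_m: "sets m = sets borel" using mms by (simp add: metric_measure_space_def)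
  obtain r0 where r0: "r0 > 0" "emeasure m (ball x r0) < \<infinity>"
    using mms by (auto simp: metric_measure_space_def)
  obtain b r1 where r1: "r1 > 0" "\<And>y. dist y x < r1 \<Longrightarrow> b \<le> k y"
    using k unfolding locally_bounded_below_def eventually_nhds_metric by meson
  define \<rho> where "\<rho> = min r0 r1 / 8"
  have \<rho>: "\<rho> > 0" "8 * \<rho> \<le> r0" "8 * \<rho> \<le> r1" using r0 r1 by (auto simp: \<rho>_def)
  have fin: "emeasure m (ball z s) < \<infinity>" if "ball z s \<subseteq> ball x (8 * \<rho>)" for z s
  proof -
    have "emeasure m (ball z s) \<le> emeasure m (ball x r0)"
      using that \<rho> sets_m by (intro emeasure_mono) auto
    then show ?thesis using r0(2) by (rule le_less_trans)
  qed
  \<comment> \<open>Chosen such that \<open>- a\<^sup>2 \<le> k/(N-1)\<close> wherever \<open>k \<ge> b\<close>.\<close>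
  define a where "a = sqrt (max 0 (- b / (N - 1)))"
  have a: "a \<ge> 0" "- a\<^sup>2 * (N - 1) \<le> b" using N by (auto simp: a_def max_def field_simps)
  have low: "\<exists>c>0. \<forall>y\<in>cball x \<rho>. ennreal c \<le> emeasure m (ball y s)" if s: "0 < s" "s \<le> \<rho>" for s
  proof -
    define L where "L = 4 * \<rho>"
    \<comment> \<open>So early that the mass has moved by less than \<open>s/2\<close>.\<close>
    define t where "t = min (1 / 2) ((s / 2)\<^sup>2 / (L\<^sup>2 + 1))"
    have L1: "L\<^sup>2 + 1 > 0" by (intro add_nonneg_pos) auto
    have t: "0 < t" "t < 1" "t \<le> 1" using s L1 by (auto simp: t_def)
    have "t * (L\<^sup>2 + 1) \<le> (s / 2)\<^sup>2 / (L\<^sup>2 + 1) * (L\<^sup>2 + 1)"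
      using L1 by (intro mult_right_mono) (auto simp: t_def)
    then have tL: "t * (L\<^sup>2 + 1) \<le> (s - s / 2)\<^sup>2" using L1 by simp
    define V where "V = measure m (ball x \<rho>)"
    have finx: "emeasure m (ball x \<rho>) < \<infinity>" using \<rho> by (intro fin) auto
    have V: "V > 0" unfolding V_def by (rule measure_ball_pos[OF supp \<rho>(1) finx])
    define d where "d = t * exp (- a * L) * V powr (1 / N)"
    have d: "d > 0" using t V by (simp add: d_def)
    have "ennreal (d powr N) \<le> emeasure m (ball y s)" if y: "y \<in> cball x \<rho>" for y
    proof -
      have sub: "ball y s \<subseteq> ball x (8 * \<rho>)"
      proof
        fix z assume "z \<in> ball y s"
        then show "z \<in> ball x (8 * \<rho>)" using y s \<rho> dist_triangle[of x z y] by auto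
      qed
      have "ennreal (t * exp (- a * L)) * ennreal (measure m (ball x \<rho>) powr (1 / N))
          \<le> ennreal (measure m (ball y s) powr (1 / N))"
      proof (rule CD_ball_estimate[OF mms supp CD N _ _ fin[OF sub] \<rho>(1) finx t(1,2) _ tL])
        show "dist y x + s / 2 + \<rho> \<le> L" using y s \<rho> by (simp add: L_def dist_commute)
        fix \<gamma> :: "real \<Rightarrow>\<^sub>C 'a"
        assume \<gamma>: "\<gamma> \<in> geodesics" "apply_bcontfun \<gamma> 0 \<in> ball y (s / 2)" "apply_bcontfun \<gamma> 1 \<in> ball x \<rho>"
        have sp: "speed \<gamma> \<le> L"
          using speed_near(1)[of y \<gamma> "s / 2" x \<rho>] \<gamma> y s \<rho> by (simp add: L_def dist_commute)
        have sp0: "speed \<gamma> \<ge> 0" by (simp add: speed_def)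
        have "t * exp (- a * L) \<le> t * exp (- a * speed \<gamma>)"
          using t sp a by (intro mult_left_mono) (auto intro: mult_left_mono)
        then have "ennreal (t * exp (- a * L)) \<le> ennreal (t * exp (- a * speed \<gamma>))"
          by (rule ennreal_leI)
        also have "\<dots> \<le> tau_coeff (k_plus k \<gamma>) N t (speed \<gamma>)"
        proof (rule tau_coeff_ge[OF N t(1,3) sp0 a(1)])
          fix q assume q: "q \<in> {0..speed \<gamma>}"
          define u where "u = q / speed \<gamma>"
          have u: "u \<in> {0..1}" using q by (cases "speed \<gamma> = 0") (auto simp: u_def)
          have "dist (apply_bcontfun \<gamma> 0) (apply_bcontfun \<gamma> u) \<le> L"
            using geodesic_dist[OF \<gamma>(1), of 0 u] u sp sp0
            by (auto intro: order_trans[OF mult_left_le_one_le])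
          moreover have "dist x (apply_bcontfun \<gamma> u) \<le> dist x y + dist y (apply_bcontfun \<gamma> 0)
              + dist (apply_bcontfun \<gamma> 0) (apply_bcontfun \<gamma> u)"
            by (rule dist_triangle4)
          ultimately have "dist (apply_bcontfun \<gamma> u) x < r1"
            using \<gamma>(2) y s \<rho> by (simp add: L_def dist_commute)
          then have "b \<le> k_plus k \<gamma> q" using r1(2) by (simp add: k_plus_def u_def)
          then show "- a\<^sup>2 * (N - 1) \<le> k_plus k \<gamma> q" using a(2) by linarith
        qed
        finally show "ennreal (t * exp (- a * L)) \<le> tau_coeff (k_plus k \<gamma>) N t (speed \<gamma>)" .
      qed (use s in auto)
      then have "ennreal d \<le> ennreal (measure m (ball y s) powr (1 / N))"
        using t by (simp add: d_def V_def ennreal_mult'[symmetric])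
      then have "d \<le> measure m (ball y s) powr (1 / N)" by (simp add: ennreal_le_iff)
      then have "d powr N \<le> (measure m (ball y s) powr (1 / N)) powr N"
        using d N by (intro powr_mono2) auto
      also have "\<dots> = measure m (ball y s)" using N by (simp add: powr_powr)
      finally have "ennreal (d powr N) \<le> ennreal (measure m (ball y s))" by (rule ennreal_leI)
      also have "\<dots> = emeasure m (ball y s)"
        using fin[OF sub] by (simp add: emeasure_eq_ennreal_measure less_top)
      finally show ?thesis .
    qed
    then show ?thesis using d by (intro exI[of _ "d powr N"]) auto
  qed
  have "compact (cball x \<rho>)"
  proof (rule compactI_totally_bounded)
    fix e :: real assume e: "e > 0"
    define s where "s = min e \<rho> / 2"
    have s: "0 < s" "s \<le> \<rho>" "2 * s \<le> e" using e \<rho> by (auto simp: s_def)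
    obtain c where c: "c > 0" "\<And>y. y \<in> cball x \<rho> \<Longrightarrow> ennreal c \<le> emeasure m (ball y s)"
      using low[OF s(1,2)] by blast
    have sub: "ball y s \<subseteq> ball x (8 * \<rho>)" if y: "y \<in> cball x \<rho>" for y
    proof
      fix z assume "z \<in> ball y s"
      then show "z \<in> ball x (8 * \<rho>)" using y s \<rho> dist_triangle[of x z y] by auto
    qed
    have "\<exists>F. finite F \<and> cball x \<rho> \<subseteq> (\<Union>x\<in>F. ball x (2 * s))"
      by (rule finite_net_if_ball_measure_ge[OF sets_m _ fin[OF subset_refl] s(1) c(1) sub c(2)]) simp_all
    then obtain F where "finite F" "cball x \<rho> \<subseteq> (\<Union>x\<in>F. ball x (2 * s))" by blast
    then show "\<exists>F. finite F \<and> cball x \<rho> \<subseteq> (\<Union>x\<in>F. ball x e)"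
      using s(3) by (intro exI[of _ F]) (auto dest!: subsetD intro: less_le_trans)
  qed simp
  then show ?thesis using \<rho>(1) by blast
qed

section \<open>Hopf-Rinow\<close>

text \<open>Let \<open>\<rho>\<close> be the supremum of the radii of compact closed balls around \<open>p\<close>. By the length property the
ball of radius \<open>\<rho>\<close> is approximated by smaller ones, so it is totally bounded and thus compact. Finitely
many compact balls cover a neighbourhood of it, which again by the length property contains a larger
ball around \<open>p\<close>.\<close>
lemma hopf_rinow_compact_cball:
  fixes p :: "'a::complete_space"
  assumes mid: "\<And>z s e. 0 \<le> s \<Longrightarrow> s \<le> dist p z \<Longrightarrow> 0 < e \<Longrightarrow> \<exists>w. dist p w \<le> s \<and> dist w z \<le> dist p z - s + e"
    and loc: "\<And>x::'a. \<exists>r>0. compact (cball x r)"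
  shows "compact (cball p D)"
proof (rule ccontr)
  assume nc: "\<not> compact (cball p D)"
  have near: "\<exists>w\<in>cball p s. dist w z < e" if "0 \<le> s" "z \<in> cball p r" "r - s < e" "0 < e" for s z r e
  proof (cases "dist p z \<le> s")
    case True
    then show ?thesis using that by (intro bexI[of _ z]) auto
  next
    case False
    define e' where "e' = (e - (r - s)) / 2"
    have e': "e' > 0" using that by (simp add: e'_def)
    have "\<exists>w. dist p w \<le> s \<and> dist w z \<le> dist p z - s + e'"
      using False that(1) e' by (intro mid) auto
    then obtain w where w: "dist p w \<le> s" "dist w z \<le> dist p z - s + e'" by blast
    have "dist p z - s + e' < e" using that by (simp add: e'_def field_simps)
    then show ?thesis using w by (intro bexI[of _ w]) auto
  qed
  have mono: "compact (cball p s)" if "compact (cball p r)" "s \<le> r" for s r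
    using that compact_Int_closed[OF that(1) closed_cball[of p s]]
    by (simp add: Int_absorb1 subset_cball)
  \<comment> \<open>Bounded by \<open>D\<close> if the ball of radius \<open>D\<close> is not compact.\<close>
  define T where "T = {r. 0 \<le> r \<and> compact (cball p r)}"
  have T0: "0 \<in> T" by (simp add: T_def)
  have bdd: "bdd_above T" using mono nc by (intro bdd_aboveI[of _ D]) (auto simp: T_def not_le intro: ccontr)
  define \<rho> where "\<rho> = Sup T"
  have \<rho>0: "0 \<le> \<rho>" unfolding \<rho>_def by (rule cSup_upper[OF T0 bdd])
  have below: "compact (cball p s)" if "s < \<rho>" for s
  proof -
    have "T \<noteq> {}" using T0 by blast
    from less_cSupD[OF this, of s] that obtain r where "r \<in> T" "s < r" by (auto simp: \<rho>_def)
    then show ?thesis using mono[of r s] by (auto simp: T_def)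
  qed
  have comp: "compact (cball p \<rho>)"
  proof (cases "\<rho> = 0")
    case False
    show ?thesis
    proof (rule compactI_totally_bounded)
      fix e :: real assume e: "e > 0"
      define s where "s = max 0 (\<rho> - e / 4)"
      have s: "0 \<le> s" "s < \<rho>" "\<rho> - s < e / 2" using \<rho>0 False e by (auto simp: s_def max_def)
      obtain F where F: "finite F" "cball p s \<subseteq> (\<Union>x\<in>F. ball x (e / 2))"
        using below[OF s(2)] e unfolding compact_eq_totally_bounded by (meson half_gt_zero)
      have "cball p \<rho> \<subseteq> (\<Union>x\<in>F. ball x e)"
      proof
        fix z assume z: "z \<in> cball p \<rho>"
        have "\<exists>w\<in>cball p s. dist w z < e / 2" by (rule near[OF s(1) z s(3)]) (use e in simp)
        then obtain w where w: "w \<in> cball p s" "dist w z < e / 2" by blast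
        then obtain x where "x \<in> F" "dist x w < e / 2" using F(2) by auto
        then show "z \<in> (\<Union>x\<in>F. ball x e)"
          using w dist_triangle_half_r[of w x e z] by (auto simp: dist_commute intro!: bexI[of _ x])
      qed
      then show "\<exists>F. finite F \<and> cball p \<rho> \<subseteq> (\<Union>x\<in>F. ball x e)" using F by blast
    qed simp
  qed simp
  have "\<forall>x::'a. \<exists>r. r > 0 \<and> compact (cball x r)" using loc by blast
  from choice[OF this] obtain r where r: "\<And>x::'a. r x > 0" "\<And>x. compact (cball x (r x))" by blast
  have "cball p \<rho> \<subseteq> (\<Union>x\<in>cball p \<rho>. ball x (r x / 2))" using r(1) by force
  then obtain C where C: "C \<subseteq> cball p \<rho>" "finite C" "cball p \<rho> \<subseteq> (\<Union>x\<in>C. ball x (r x / 2))"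
    using compactE_image[OF comp, of "cball p \<rho>" "\<lambda>x. ball x (r x / 2)"] by (metis open_ball)
  have C0: "C \<noteq> {}" using C(3) \<rho>0 by auto
  define \<eta> where "\<eta> = Min ((\<lambda>x. r x / 2) ` C)"
  have \<eta>: "\<eta> > 0" using C(2) C0 r(1) by (simp add: \<eta>_def)
  have \<eta>_le: "\<eta> \<le> r x / 2" if "x \<in> C" for x
    unfolding \<eta>_def using C(2) that by (intro Min_le) auto
  have sub: "cball p (\<rho> + \<eta> / 2) \<subseteq> (\<Union>x\<in>C. cball x (r x))"
  proof
    fix z assume z: "z \<in> cball p (\<rho> + \<eta> / 2)"
    have "\<exists>w\<in>cball p \<rho>. dist w z < \<eta>" by (rule near[OF \<rho>0 z]) (use \<eta> in simp_all)
    then obtain w where w: "w \<in> cball p \<rho>" "dist w z < \<eta>" by blast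
    then obtain x where x: "x \<in> C" "dist x w < r x / 2" using C(3) by auto
    then show "z \<in> (\<Union>x\<in>C. cball x (r x))"
      using w \<eta>_le[OF x(1)] dist_triangle[of x z w] by (intro UN_I[of x]) auto
  qed
  have "compact (\<Union>x\<in>C. cball x (r x))" using C r by (intro compact_UN) auto
  from compact_Int_closed[OF this closed_cball[of p "\<rho> + \<eta> / 2"]]
  have "compact (cball p (\<rho> + \<eta> / 2))" using sub by (simp add: Int_absorb1)
  then have "\<rho> + \<eta> / 2 \<in> T" using \<rho>0 \<eta> by (simp add: T_def)
  then have "\<rho> + \<eta> / 2 \<le> \<rho>" unfolding \<rho>_def by (rule cSup_upper[OF _ bdd])
  then show False using \<eta> by simp
qed

section \<open>Boundedness\<close>

text \<open>If \<open>y\<close> is too far from \<open>p\<close>, choose \<open>q\<close> almost on the way from \<open>p\<close> to \<open>y\<close> with \<open>d(p,q)\<close> about \<open>R + 3\<close>. A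
geodesic from near \<open>q\<close> to near \<open>y\<close> that met \<open>B(p,R)\<close> would be longer than the distance of its ends
allows. So it stays where \<open>k\<close> is controlled, and \<open>d(p, \<cdot>)\<close> is at most \<open>s + b\<close> at its parameter \<open>s\<close>. Its
length exceeds the distance of consecutive zeros of the Euler equation, hence its coefficient is
infinite, and the ball \<open>B(q,r)\<close> would have infinite measure.\<close>
lemma CD_bounded:
  fixes m :: "'a::polish_space measure" and p :: 'a
  assumes mms: "metric_measure_space m" and supp: "msupp m = UNIV" and CD: "CD m k N"
    and N: "N > 1" and c: "c > (N - 1) / 4" and R: "R > 0"
    and k: "\<And>x. dist p x > R \<Longrightarrow> k x \<ge> c / (dist p x)\<^sup>2"
  shows "\<exists>D. \<forall>y. dist p y \<le> D"
proof -
  define \<omega> where "\<omega> = sqrt (c / (N - 1) - 1 / 4)"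
  have c': "c / (N - 1) > 1 / 4" using c N by (simp add: field_simps)
  then have \<omega>: "\<omega> > 0" "1 / 4 + \<omega>\<^sup>2 = c / (N - 1)" by (auto simp: \<omega>_def)
  have c0: "c > 0" using c N divide_pos_pos[of "N - 1" 4] by linarith
  define b where "b = R + 4"
  have b: "b > 0" using R by (simp add: b_def)
  define T where "T = b * exp (pi / \<omega>) - b"
  have T: "T > 0" using b \<omega> by (simp add: T_def)
  have fin: "\<exists>r>0. r \<le> 1 / 4 \<and> emeasure m (ball z r) < \<infinity>" for z
    by (rule finite_measure_small_ball[OF mms]) simp
  have "dist p y \<le> T + b" for y
  proof (rule ccontr)
    assume "\<not> dist p y \<le> T + b"
    then have y: "dist p y > T + b" by simp
    obtain q where q: "dist p q \<le> R + 3" "dist q y \<le> dist p y - (R + 3) + 1 / 4"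
      using CD_intermediate_point[OF mms supp CD, of "R + 3" p y "1 / 4"] y T R by (auto simp: b_def)
    have pq: "R + 3 - 1 / 4 \<le> dist p q" using q dist_triangle[of p y q] by simp
    have qy: "dist p y - (R + 3) \<le> dist q y" using q dist_triangle[of p y q] by simp
    obtain r where r: "r > 0" "r \<le> 1 / 4" "emeasure m (ball q r) < \<infinity>" using fin by blast
    obtain \<eta> where \<eta>: "\<eta> > 0" "\<eta> \<le> 1 / 4" "emeasure m (ball y \<eta>) < \<infinity>" using fin by blast
    define L where "L = dist q y + r / 2 + \<eta>"
    have L1: "L\<^sup>2 + 1 > 0" by (intro add_nonneg_pos) auto
    \<comment> \<open>So early that the mass is still in \<open>B(q,r)\<close>.\<close>
    define t where "t = min (1 / 2) ((r / 2)\<^sup>2 / (L\<^sup>2 + 1))"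
    have t: "0 < t" "t < 1" "t \<in> {0..1}" using r L1 by (auto simp: t_def)
    have "t * (L\<^sup>2 + 1) \<le> (r / 2)\<^sup>2 / (L\<^sup>2 + 1) * (L\<^sup>2 + 1)"
      using L1 by (intro mult_right_mono) (auto simp: t_def)
    then have tL: "t * (L\<^sup>2 + 1) \<le> (r - r / 2)\<^sup>2" using L1 by simp
    have "\<infinity> * ennreal (measure m (ball y \<eta>) powr (1 / N)) \<le> ennreal (measure m (ball q r) powr (1 / N))"
    proof (rule CD_ball_estimate[OF mms supp CD N _ _ r(3) \<eta>(1,3) t(1,2) _ tL])
      fix \<gamma> :: "real \<Rightarrow>\<^sub>C 'a"
      assume \<gamma>: "\<gamma> \<in> geodesics" "apply_bcontfun \<gamma> 0 \<in> ball q (r / 2)" "apply_bcontfun \<gamma> 1 \<in> ball y \<eta>"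
      define \<theta> where "\<theta> = speed \<gamma>"
      have \<theta>: "\<theta> \<le> dist p y - R - 9 / 4" "T \<le> \<theta>"
        using speed_near[of q \<gamma> "r / 2" y \<eta>] \<gamma> q qy r \<eta> y by (auto simp: \<theta>_def b_def)
      have "sigma_coeff (\<lambda>s. k_plus k \<gamma> s / (N - 1)) t \<theta> = \<infinity>"
      proof (rule sigma_coeff_euler_infinite[OF b \<omega>(1) _ \<theta>(2)[unfolded T_def] t(3)])
        fix s assume s: "s \<in> {0..\<theta>}"
        define u where "u = s / \<theta>"
        have u: "u \<in> {0..1}" "u * \<theta> = s" using s \<theta> T by (auto simp: u_def)
        define z where "z = apply_bcontfun \<gamma> u"
        have d: "dist (apply_bcontfun \<gamma> 0) z = s" "dist z (apply_bcontfun \<gamma> 1) = \<theta> - s"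
          using geodesic_dist[OF \<gamma>(1), of 0 u] geodesic_dist[OF \<gamma>(1), of u 1] u
          by (auto simp: z_def \<theta>_def[symmetric] algebra_simps)
        have far: "dist p z > R"
        proof (rule ccontr)
          assume "\<not> dist p z > R"
          then have pz: "dist p z \<le> R" by simp
          have "dist p q \<le> dist p z + dist (apply_bcontfun \<gamma> 0) z + dist q (apply_bcontfun \<gamma> 0)"
            using dist_triangle4[of p q z "apply_bcontfun \<gamma> 0"] by (simp add: dist_commute)
          moreover have "dist p y \<le> dist p z + dist z (apply_bcontfun \<gamma> 1) + dist y (apply_bcontfun \<gamma> 1)"
            using dist_triangle4[of p y z "apply_bcontfun \<gamma> 1"] by (simp add: dist_commute)
          ultimately show False using pz d pq \<theta>(1) \<gamma>(2,3) r \<eta> R by simp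
        qed
        have "dist p z \<le> dist p q + dist q (apply_bcontfun \<gamma> 0) + dist (apply_bcontfun \<gamma> 0) z"
          by (rule dist_triangle4)
        then have "dist p z \<le> s + b" using q(1) \<gamma>(2) r d by (simp add: b_def)
        then have "c / (s + b)\<^sup>2 \<le> c / (dist p z)\<^sup>2"
          using c0 far R s b by (intro divide_left_mono power_mono mult_pos_pos zero_less_power) auto
        also have "\<dots> \<le> k_plus k \<gamma> s" using k[OF far] by (simp add: k_plus_def z_def u_def \<theta>_def)
        finally have "c / (s + b)\<^sup>2 / (N - 1) \<le> k_plus k \<gamma> s / (N - 1)" using N by (intro divide_right_mono) auto
        then show "(1 / 4 + \<omega>\<^sup>2) / (s + b)\<^sup>2 \<le> k_plus k \<gamma> s / (N - 1)"
          by (simp add: \<omega>(2) mult.commute)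
      qed
      then show "\<infinity> \<le> tau_coeff (k_plus k \<gamma>) N t (speed \<gamma>)"
        using t by (simp add: tau_coeff_def epowr_def \<theta>_def ennreal_mult_top)
    qed (use r in \<open>auto simp: L_def\<close>)
    moreover have "measure m (ball y \<eta>) > 0" by (rule measure_ball_pos[OF supp \<eta>(1,3)])
    ultimately show False by (simp add: ennreal_top_mult top_unique)
  qed
  then show ?thesis by blast
qed

theorem theorem5p10:
  fixes m :: "'a::polish_space measure" and k :: "'a \<Rightarrow> real"
    and N c R :: real and p :: 'a
  assumes "metric_measure_space m"
    and "msupp m = UNIV"
    and "admissible k"
    and "N > 1"
    and "CD m k N"
    and "c > (N - 1) / 4"
    and "R > 0"
    and "\<forall>x. dist p x > R \<longrightarrow> k x \<ge> c * dist p x powi (- 2)"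
  shows "compact (UNIV :: 'a set)"
proof -
  note CD = assms(1,2,5)
  have "k x \<ge> c / (dist p x)\<^sup>2" if "dist p x > R" for x
    using assms(8) that by (simp add: power_int_minus divide_inverse)
  from CD_bounded[OF CD assms(4,6,7) this] obtain D where "\<forall>y. dist p y \<le> D" by blast
  then have "UNIV = cball p D" by auto
  moreover have "compact (cball p D)"
  proof (rule hopf_rinow_compact_cball)
    show "\<exists>w. dist p w \<le> s \<and> dist w z \<le> dist p z - s + e"
      if "0 \<le> s" "s \<le> dist p z" "0 < e" for z s e
      by (rule CD_intermediate_point[OF CD that])
    show "\<exists>r>0. compact (cball x r)" for x :: 'a
      using CD_locally_compact[OF CD assms(4)] assms(3) by (simp add: admissible_def)
  qed
  ultimately show ?thesis by simp
qed

end
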